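(* For any biquandle $X$, any biquandle virtual bracket $\beta=(A,B,C,D,U,V,\delta,w)$ over $X$ with values in a commutative ring with identity $R$, and any oriented virtual link $L$, the multiset of state sum values \[\Phi_X^{\beta,M}(L)=\{\beta_f\ |\ f\in\mathrm{Hom}(\mathcal{B}(L),X)\}\] is an invariant of classical and virtual links. Here $\mathrm{Hom}(\mathcal{B}(L),X)$ denotes the set of $X$-colorings of a diagram of $L$; thus the multiset computed from a diagram of $L$ does not depend on the choice of the diagram of the oriented virtual link $L$.
   Context: **Biquandle.** A biquandle is a set $X$ with two operations $\underline{\triangleright},\overline{\triangleright}:X\times X\to X$, written $x^y:=x\,\underline{\triangleright}\,y$ and $x_y:=x\,\overline{\triangleright}\,y$, such that for all $x,y,z\in X$: (i) $x^x=x_x$; (ii) the maps $\alpha_x(y)=y_x$ and $\beta_x(y)=y^x$ on $X$, and $S(x,y)=(y_x,x^y)$ on $X\times X$, are invertible; (iii) $(x\underline{\triangleright}y)\underline{\triangleright}(z\underline{\triangleright}y)=(x\underline{\triangleright}z)\underline{\triangleright}(y\overline{\triangleright}z)$, $(x\underline{\triangleright}y)\overline{\triangleright}(z\underline{\triangleright}y)=(x\overline{\triangleright}z)\underline{\triangleright}(y\overline{\triangleright}z)$, $(x\overline{\triangleright}y)\overline{\triangleright}(z\overline{\triangleright}y)=(x\overline{\triangleright}z)\overline{\triangleright}(y\underline{\triangleright}z)$. **Virtual links.** An oriented virtual link diagram is an oriented planar link diagram whose double points are classical (over/under) crossings or virtual crossings. Oriented virtual links are equivalence classes of such diagrams under planar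 isotopy and the oriented virtual Reidemeister moves: the classical moves I, II, III (with all orientations), their purely virtual analogues vI, vII, vIII (all crossings virtual), and the mixed move v (a strand with two virtual crossings is moved past a classical crossing). Classical links are those having a diagram without virtual crossings. **Colorings.** An $X$-coloring of a diagram assigns an element of $X$ to each semiarc (portion between classical crossings; labels pass through virtual crossings unchanged) so that at every classical crossing, drawn with both strands directed downward, the following holds: if $x$ is the label of the left-hand semiarc of the under-strand and $y$ is the label of the left-hand semiarc of the over-strand, then the right-hand semiarc of the under-strand has label $x\underline{\triangleright}y$ and that of the over-strand has label $y\overline{\triangleright}x$. This rule applies at both positive and negative crossings. A crossing drawn downward is positive if the over-strand runs from upper right to lower left, and negative if it runs from upper left to lower right. We call $(x,y)$ the color pair of the crossing. The fundamental biquandle $\mathcal B(L)$ is the biquandle generated by the semiarcs of a diagram of $L$ subject to these crossing relations, so biquandle homomorphisms $\mathcal B(L)\to X$ are the same as $X$-colorings of the diagram. For each move, every coloring before the move corresponds to a unique coloring after it that agrees outside the move region. **Biquandle virtual bracket.** It consists of maps $A,B,C,D,U,V:X\times X\to R$ and elements $\delta\in R$, $w\in R^\times$ such that for all $x,y,z\in X$ the following hold. (i) $w=\delta A_{x,x}+B_{x,x}+V_{x,x}$ and $w^{-1}=\delta C_{x,x}+D_{x,x}+U_{x,x}$. (ii) Omitting the index $x,y$ on every factor: $1=AC+VU$, $1=BD+VU$, $0=AU+VC$, $0=BU+VD$, $0=\delta BD+AD+BC$, $0=\delta AC+AD+BC$. (iii) For letters $P,Q,T\in\{A,B,V\}$ write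 $[PQT]:=P_{x,y}\,Q_{x^y,z_y}\,T_{y,z}$ and $[PQT]':=P_{y_x,z_x}\,Q_{x,z}\,T_{x^z,y^z}$. Then: 1. $[AAA]+[VAV]=[AAA]'+[VAV]'$ 2. $[AAB]+[BAA]+\delta[BAB]+[BAV]+[BBB]+[BVB]+[VAB]=[ABA]'$ 3. $[ABA]=[AAB]'+[BAA]'+\delta[BAB]'+[BAV]'+[BBB]'+[BVB]'+[VAB]'$ 4. $[AVA]=[AAV]'+[VAA]'$ 5. $[AAV]+[VAA]=[AVA]'$ 6. $[BBA]+[BVV]=[ABB]'+[VVB]'$ 7. $[ABB]+[VVB]=[BBA]'+[BVV]'$ 8. $[BBV]+[BVA]=[ABV]'$ 9. $[ABV]=[BBV]'+[BVA]'$ 10. $[VBA]=[AVB]'+[VBB]'$ 11. $[AVB]+[VBB]=[VBA]'$ 12. $[VVA]=[AVV]'$ 13. $[AVV]=[VVA]'$ 14. $[VBV]=[VBV]'$ 15. $[VVV]=[VVV]'$ **States and state sum.** Let $f$ be an $X$-coloring of a diagram with $p$ positive and $n$ negative classical crossings. A state $S$ is a choice, at each classical crossing, of one of three replacements: the smoothing compatible with orientation (without crossing, joining each incoming end to the outgoing end of the other strand); the smoothing against orientation (joining the two incoming ends to each other and the two outgoing ends to each other); or replacement by a virtual crossing. For a crossing with color pair $(x,y)$ these choices have coefficients $A_{x,y},B_{x,y},V_{x,y}$ respectively if the crossing is positive, and $C_{x,y},D_{x,y},U_{x,y}$ respectively if it is negative. Then $\beta_S$ is the product of the coefficients of all choices,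 times $\delta^k$, times $w^{n-p}$, where $k$ is the number of closed curves of the resulting diagram (curves may cross themselves and each other at virtual crossings). The state sum is $\beta_f=\sum_S\beta_S\in R$, over all $3^{n+p}$ states. *)

theory Defs
  imports Main "HOL-Library.Equipollence" "HOL-Library.Multiset"
begin

section \<open>Biquandles and biquandle virtual brackets\<close>

text \<open>\<open>utri x y\<close> is $x^y$ and \<open>otri x y\<close> is $x_y$.\<close>

locale biquandle =
  fixes utri otri :: "'x \<Rightarrow> 'x \<Rightarrow> 'x"
  assumes diagonal: "utri x x = otri x x"
    and alpha_bij: "bij (\<lambda>y. otri y x)"
    and beta_bij: "bij (\<lambda>y. utri y x)"
    and S_bij: "bij (\<lambda>(x, y). (otri y x, utri x y))"
    and exchange_uu: "utri (utri x y) (utri z y) = utri (utri x z) (otri y z)"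
    and exchange_uo: "otri (utri x y) (utri z y) = utri (otri x z) (otri y z)"
    and exchange_oo: "otri (otri x y) (otri z y) = otri (otri x z) (utri y z)"

text \<open>
  The products $[PQT]$ and $[PQT]'$: the coefficients collected along the two sides of the
  third Reidemeister move with all three crossings positive.
\<close>

definition tri ::
  "('x \<Rightarrow> 'x \<Rightarrow> 'x) \<Rightarrow> ('x \<Rightarrow> 'x \<Rightarrow> 'x) \<Rightarrow>
   ('x \<Rightarrow> 'x \<Rightarrow> 'r::times) \<Rightarrow> ('x \<Rightarrow> 'x \<Rightarrow> 'r) \<Rightarrow> ('x \<Rightarrow> 'x \<Rightarrow> 'r) \<Rightarrow> 'x \<Rightarrow> 'x \<Rightarrow> 'x \<Rightarrow> 'r" where
  "tri utri otri P Q T x y z = P x y * Q (utri x y) (otri z y) * T y z"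

definition tri' ::
  "('x \<Rightarrow> 'x \<Rightarrow> 'x) \<Rightarrow> ('x \<Rightarrow> 'x \<Rightarrow> 'x) \<Rightarrow>
   ('x \<Rightarrow> 'x \<Rightarrow> 'r::times) \<Rightarrow> ('x \<Rightarrow> 'x \<Rightarrow> 'r) \<Rightarrow> ('x \<Rightarrow> 'x \<Rightarrow> 'r) \<Rightarrow> 'x \<Rightarrow> 'x \<Rightarrow> 'x \<Rightarrow> 'r" where
  "tri' utri otri P Q T x y z = P (otri y x) (otri z x) * Q x z * T (utri x z) (utri y z)"

text \<open>
  The sort \<open>{comm_ring, comm_monoid_mult}\<close> is that of commutative rings with identity;
  unlike \<open>comm_ring_1\<close> it does not exclude the zero ring.
  The unit \<open>w\<close> comes with its (unique) inverse \<open>w'\<close>.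
\<close>

locale biquandle_virtual_bracket = biquandle utri otri
  for utri otri :: "'x \<Rightarrow> 'x \<Rightarrow> 'x" +
  fixes A B C D U V :: "'x \<Rightarrow> 'x \<Rightarrow> 'r::{comm_ring, comm_monoid_mult}"
    and \<delta> w w' :: 'r
  assumes unit: "w * w' = 1"
    and i_pos: "w = \<delta> * A x x + B x x + V x x"
    and i_neg: "w' = \<delta> * C x x + D x x + U x x"
    and ii_1: "1 = A x y * C x y + V x y * U x y"
    and ii_2: "1 = B x y * D x y + V x y * U x y"
    and ii_3: "0 = A x y * U x y + V x y * C x y"
    and ii_4: "0 = B x y * U x y + V x y * D x y"
    and ii_5: "0 = \<delta> * B x y * D x y + A x y * D x y + B x y * C x y"
    and ii_6: "0 = \<delta> * A x y * C x y + A x y * D x y + B x y * C x y"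
    and iii_1: "tri utri otri A A A x y z + tri utri otri V A V x y z
        = tri' utri otri A A A x y z + tri' utri otri V A V x y z"
    and iii_2: "tri utri otri A A B x y z + tri utri otri B A A x y z
          + \<delta> * tri utri otri B A B x y z + tri utri otri B A V x y z
          + tri utri otri B B B x y z + tri utri otri B V B x y z
          + tri utri otri V A B x y z
        = tri' utri otri A B A x y z"
    and iii_3: "tri utri otri A B A x y z
        = tri' utri otri A A B x y z + tri' utri otri B A A x y z
          + \<delta> * tri' utri otri B A B x y z + tri' utri otri B A V x y z
          + tri' utri otri B B B x y z + tri' utri otri B V B x y z
          + tri' utri otri V A B x y z"
    and iii_4: "tri utri otri A V A x y z
        = tri' utri otri A A V x y z + tri' utri otri V A A x y z"
    and iii_5: "tri utri otri A A V x y z + tri utri otri V A A x y z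
        = tri' utri otri A V A x y z"
    and iii_6: "tri utri otri B B A x y z + tri utri otri B V V x y z
        = tri' utri otri A B B x y z + tri' utri otri V V B x y z"
    and iii_7: "tri utri otri A B B x y z + tri utri otri V V B x y z
        = tri' utri otri B B A x y z + tri' utri otri B V V x y z"
    and iii_8: "tri utri otri B B V x y z + tri utri otri B V A x y z
        = tri' utri otri A B V x y z"
    and iii_9: "tri utri otri A B V x y z
        = tri' utri otri B B V x y z + tri' utri otri B V A x y z"
    and iii_10: "tri utri otri V B A x y z
        = tri' utri otri A V B x y z + tri' utri otri V B B x y z"
    and iii_11: "tri utri otri A V B x y z + tri utri otri V B B x y z
        = tri' utri otri V B A x y z"
    and iii_12: "tri utri otri V V A x y z = tri' utri otri A V V x y z"
    and iii_13: "tri utri otri A V V x y z = tri' utri otri V V A x y z"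
    and iii_14: "tri utri otri V B V x y z = tri' utri otri V B V x y z"
    and iii_15: "tri utri otri V V V x y z = tri' utri otri V V V x y z"


section \<open>Oriented virtual link diagrams\<close>

text \<open>
  A diagram is recorded as a plane graph up to isotopy, that is, as a combinatorial map.
  Its edges carry names and are directed by the orientation of the link.  In
  \<open>Crossing k nw ne sw se\<close> the crossing is drawn with both strands directed downward, and
  \<open>nw\<close>, \<open>ne\<close>, \<open>sw\<close>, \<open>se\<close> are the edges at its four corners: the two strands run from \<open>nw\<close> to
  \<open>se\<close> and from \<open>ne\<close> to \<open>sw\<close>; the latter is the over-strand of a positive and the former
  that of a negative crossing.

  \<open>Mark a b\<close> is an auxiliary point on a strand, where the edge \<open>a\<close> ends and \<open>b\<close> begins.  With
  marks, closed curves that meet no crossing, such as \<open>{Mark a a}\<close>, need no special treatment.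

  The position of the connected components of the graph relative to each other is not recorded:
  it affects neither colorings nor state sums, and leaving it out only enlarges the equivalence
  relation on diagrams defined below.
\<close>

datatype kind = Positive | Negative | Virtual

datatype 'e vertex = Mark 'e 'e | Crossing kind 'e 'e 'e 'e

type_synonym diagram = "nat vertex set"

fun ins :: "'e vertex \<Rightarrow> 'e list" where
  "ins (Mark a b) = [a]"
| "ins (Crossing k nw ne sw se) = [nw, ne]"

fun outs :: "'e vertex \<Rightarrow> 'e list" where
  "outs (Mark a b) = [b]"
| "outs (Crossing k nw ne sw se) = [sw, se]"

definition edges :: "diagram \<Rightarrow> nat set" where
  "edges K = (\<Union>v\<in>K. set_vertex v)"

definition well_formed :: "diagram \<Rightarrow> bool" where
  "well_formed K \<longleftrightarrow> finite K \<and>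
     (\<forall>e\<in>edges K. (\<Sum>v\<in>K. count_list (ins v) e) = 1 \<and> (\<Sum>v\<in>K. count_list (outs v) e) = 1)"

text \<open>The classes of the equivalence relation on \<open>A\<close> generated by \<open>r\<close>.\<close>

definition classes :: "'a set \<Rightarrow> ('a \<times> 'a) set \<Rightarrow> 'a set set" where
  "classes A r = A // (r \<union> r\<inverse>)\<^sup>*"

text \<open>
  Planarity is Euler's formula.  A dart \<open>(e, True)\<close> or \<open>(e, False)\<close> is the edge \<open>e\<close> run along,
  respectively against, its direction.  On arriving at a vertex, one continues along the
  boundary of the face to the right by leaving through the next corner counterclockwise.
  The faces are the orbits of this rule.
\<close>

fun corners :: "'e vertex \<Rightarrow> (('e \<times> bool) \<times> ('e \<times> bool)) set" where
  "corners (Mark a b) = {((a, True), (b, True)), ((b, False), (a, False))}"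
| "corners (Crossing k nw ne sw se) =
     {((nw, True), (sw, True)), ((sw, False), (se, True)),
      ((se, False), (ne, False)), ((ne, True), (nw, False))}"

definition faces :: "diagram \<Rightarrow> (nat \<times> bool) set set" where
  "faces K = classes (edges K \<times> UNIV) (\<Union>v\<in>K. corners v)"

definition graph_components :: "diagram \<Rightarrow> nat set set" where
  "graph_components K = classes (edges K) (\<Union>v\<in>K. set_vertex v \<times> set_vertex v)"

text \<open>
  $|V| - |E| + |F| = 2c$: each of the $c$ connected components of the underlying graph
  has genus $0$.
\<close>

definition planar :: "diagram \<Rightarrow> bool" where
  "planar K \<longleftrightarrow> card K + card (faces K) = card (edges K) + 2 * card (graph_components K)"

definition virtual_link_diagram :: "diagram \<Rightarrow> bool" where
  "virtual_link_diagram K \<longleftrightarrow> well_formed K \<and> planar K"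


section \<open>Oriented virtual Reidemeister moves\<close>

text \<open>
  To cover all orientations of the strands, the moves are given by pictures whose strands are
  not all directed downward.  \<open>tile l d1 d2 a b c d\<close> is a crossing with the edges \<open>a\<close>, \<open>b\<close>,
  \<open>c\<close>, \<open>d\<close> at the NW, NE, SW, SE corners of the picture.  The truth values \<open>d1\<close> and \<open>d2\<close> tell
  whether the NW-SE strand and the NE-SW strand are directed downward in the picture, and \<open>l\<close>
  tells whether the NW-SE strand passes over, under, or virtually.  Rotating the picture
  until both strands are directed downward gives the vertex on the right.
\<close>

datatype layer = Over | Under | Flat

fun flip :: "layer \<Rightarrow> layer" where
  "flip Over = Under"
| "flip Under = Over"
| "flip Flat = Flat"

fun parallel_kind :: "layer \<Rightarrow> kind" where
  "parallel_kind Over = Negative"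
| "parallel_kind Under = Positive"
| "parallel_kind Flat = Virtual"

fun tile :: "layer \<Rightarrow> bool \<Rightarrow> bool \<Rightarrow> 'e \<Rightarrow> 'e \<Rightarrow> 'e \<Rightarrow> 'e \<Rightarrow> 'e vertex" where
  "tile l True True a b c d = Crossing (parallel_kind l) a b c d"
| "tile l False False a b c d = Crossing (parallel_kind l) d c b a"
| "tile l True False a b c d = Crossing (parallel_kind (flip l)) c a d b"
| "tile l False True a b c d = Crossing (parallel_kind (flip l)) b d a c"

text \<open>A strand with upper end \<open>a\<close> and lower end \<open>b\<close>.\<close>

definition strand :: "bool \<Rightarrow> 'e \<Rightarrow> 'e \<Rightarrow> 'e vertex" where
  "strand d a b = (if d then Mark a b else Mark b a)"

text \<open>
  In the following pictures \<open>a\<close>, \<open>b\<close>, \<open>c\<close> are the upper and \<open>d\<close>, \<open>e\<close>, \<open>f\<close> the lower ends,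
  each from left to right; \<open>p\<close>, \<open>q\<close>, \<open>r\<close> are the inner edges.  Strand \<open>i\<close> is the one starting
  at the \<open>i\<close>-th upper end, \<open>di\<close> is its direction, and \<open>lij\<close> tells how strand \<open>i\<close> passes
  strand \<open>j\<close>.

  The \<open>kink\<close> has its loop on the right; turned upside down, it has it on the left.
\<close>

definition kink :: "layer \<Rightarrow> bool \<Rightarrow> nat \<Rightarrow> nat \<Rightarrow> nat \<Rightarrow> diagram" where
  "kink l d1 a d p = {tile l d1 d1 a p d p}"

definition bigon ::
  "layer \<Rightarrow> bool \<Rightarrow> bool \<Rightarrow> nat \<Rightarrow> nat \<Rightarrow> nat \<Rightarrow> nat \<Rightarrow> nat \<Rightarrow> nat \<Rightarrow> diagram" where
  "bigon l12 d1 d2 a b d e p q =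
     {tile l12 d1 d2 a b p q,
      tile (flip l12) d2 d1 p q d e}"

definition left_triangle ::
  "layer \<Rightarrow> layer \<Rightarrow> layer \<Rightarrow> bool \<Rightarrow> bool \<Rightarrow> bool \<Rightarrow>
   nat \<Rightarrow> nat \<Rightarrow> nat \<Rightarrow> nat \<Rightarrow> nat \<Rightarrow> nat \<Rightarrow> nat \<Rightarrow> nat \<Rightarrow> nat \<Rightarrow> diagram" where
  "left_triangle l12 l13 l23 d1 d2 d3 a b c d e f p q r =
     {tile l12 d1 d2 a b p q,
      tile l13 d1 d3 q c r f,
      tile l23 d2 d3 p r d e}"

definition right_triangle ::
  "layer \<Rightarrow> layer \<Rightarrow> layer \<Rightarrow> bool \<Rightarrow> bool \<Rightarrow> bool \<Rightarrow>
   nat \<Rightarrow> nat \<Rightarrow> nat \<Rightarrow> nat \<Rightarrow> nat \<Rightarrow> nat \<Rightarrow> nat \<Rightarrow> nat \<Rightarrow> nat \<Rightarrow> diagram" where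
  "right_triangle l12 l13 l23 d1 d2 d3 a b c d e f p q r =
     {tile l23 d2 d3 b c p q,
      tile l13 d1 d3 a p d r,
      tile l12 d1 d2 r q e f}"

text \<open>How a strand at height \<open>h\<close> passes a strand at height \<open>h'\<close>.\<close>

definition passing :: "nat \<Rightarrow> nat \<Rightarrow> layer" where
  "passing h h' = (if h' < h then Over else Under)"

text \<open>
  The first two rules express planar isotopy: naming the edges and placing marks is immaterial.
  In every move \<open>R\<close> is the part of the diagram outside the disk in which the move takes place.
  The rules are meant for diagrams: \<open>equivalent\<close> requires both sides to be diagrams, so that the
  ends of the picture are attached to \<open>R\<close> consistently and planarity is respected.
\<close>

inductive move :: "diagram \<Rightarrow> diagram \<Rightarrow> bool" where
  rename: "inj_on g (edges K) \<Longrightarrow> move K (map_vertex g ` K)"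
| unmark: "a \<noteq> b \<Longrightarrow> Mark a b \<notin> R \<Longrightarrow>
    move (R \<union> {Mark a b}) (map_vertex (id(b := a)) ` R)"
| I: "l \<noteq> Flat \<Longrightarrow> p \<notin> edges R \<union> {a, d} \<Longrightarrow>
    move (R \<union> kink l d1 a d p) (R \<union> {strand d1 a d})"
| II: "l \<noteq> Flat \<Longrightarrow> p \<noteq> q \<Longrightarrow> {p, q} \<inter> (edges R \<union> {a, b, d, e}) = {} \<Longrightarrow>
    move (R \<union> bigon l d1 d2 a b d e p q) (R \<union> {strand d1 a d, strand d2 b e})"
| III: "distinct [h1, h2, h3] \<Longrightarrow>
    l12 = passing h1 h2 \<Longrightarrow> l13 = passing h1 h3 \<Longrightarrow> l23 = passing h2 h3 \<Longrightarrow>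
    distinct [p, q, r] \<Longrightarrow> {p, q, r} \<inter> (edges R \<union> {a, b, c, d, e, f}) = {} \<Longrightarrow>
    move (R \<union> left_triangle l12 l13 l23 d1 d2 d3 a b c d e f p q r)
         (R \<union> right_triangle l12 l13 l23 d1 d2 d3 a b c d e f p q r)"
| vI: "p \<notin> edges R \<union> {a, d} \<Longrightarrow>
    move (R \<union> kink Flat d1 a d p) (R \<union> {strand d1 a d})"
| vII: "p \<noteq> q \<Longrightarrow> {p, q} \<inter> (edges R \<union> {a, b, d, e}) = {} \<Longrightarrow>
    move (R \<union> bigon Flat d1 d2 a b d e p q) (R \<union> {strand d1 a d, strand d2 b e})"
| vIII: "distinct [p, q, r] \<Longrightarrow> {p, q, r} \<inter> (edges R \<union> {a, b, c, d, e, f}) = {} \<Longrightarrow>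
    move (R \<union> left_triangle Flat Flat Flat d1 d2 d3 a b c d e f p q r)
         (R \<union> right_triangle Flat Flat Flat d1 d2 d3 a b c d e f p q r)"
| v: "l \<noteq> Flat \<Longrightarrow>
    (l12, l13, l23) \<in> {(Flat, Flat, l), (Flat, l, Flat), (l, Flat, Flat)} \<Longrightarrow>
    distinct [p, q, r] \<Longrightarrow> {p, q, r} \<inter> (edges R \<union> {a, b, c, d, e, f}) = {} \<Longrightarrow>
    move (R \<union> left_triangle l12 l13 l23 d1 d2 d3 a b c d e f p q r)
         (R \<union> right_triangle l12 l13 l23 d1 d2 d3 a b c d e f p q r)"

text \<open>Diagrams are equivalent if they represent the same oriented virtual link.\<close>

inductive equivalent :: "diagram \<Rightarrow> diagram \<Rightarrow> bool" where
  refl: "virtual_link_diagram K \<Longrightarrow> equivalent K K"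
| forward: "equivalent K L \<Longrightarrow> move L M \<Longrightarrow> virtual_link_diagram M \<Longrightarrow> equivalent K M"
| backward: "equivalent K L \<Longrightarrow> move M L \<Longrightarrow> virtual_link_diagram M \<Longrightarrow> equivalent K M"


section \<open>Colorings and the state sum\<close>

text \<open>
  A coloring of the semiarcs is a coloring of the edges that does not change at marks and along
  the strands of virtual crossings.
\<close>

fun colored :: "('x \<Rightarrow> 'x \<Rightarrow> 'x) \<Rightarrow> ('x \<Rightarrow> 'x \<Rightarrow> 'x) \<Rightarrow> ('e \<Rightarrow> 'x) \<Rightarrow> 'e vertex \<Rightarrow> bool" where
  "colored utri otri \<phi> (Mark a b) \<longleftrightarrow> \<phi> a = \<phi> b"
| "colored utri otri \<phi> (Crossing Positive nw ne sw se) \<longleftrightarrow>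
     \<phi> se = utri (\<phi> nw) (\<phi> sw) \<and> \<phi> ne = otri (\<phi> sw) (\<phi> nw)"
| "colored utri otri \<phi> (Crossing Negative nw ne sw se) \<longleftrightarrow>
     \<phi> ne = utri (\<phi> sw) (\<phi> nw) \<and> \<phi> se = otri (\<phi> nw) (\<phi> sw)"
| "colored utri otri \<phi> (Crossing Virtual nw ne sw se) \<longleftrightarrow> \<phi> nw = \<phi> se \<and> \<phi> ne = \<phi> sw"

definition colorings ::
  "('x \<Rightarrow> 'x \<Rightarrow> 'x) \<Rightarrow> ('x \<Rightarrow> 'x \<Rightarrow> 'x) \<Rightarrow> diagram \<Rightarrow> (nat \<Rightarrow> 'x) set" where
  "colorings utri otri K =
     {\<phi> \<in> extensional (edges K). \<forall>v\<in>K. colored utri otri \<phi> v}"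

fun is_positive :: "'e vertex \<Rightarrow> bool" where
  "is_positive (Crossing k nw ne sw se) \<longleftrightarrow> k = Positive"
| "is_positive (Mark a b) \<longleftrightarrow> False"

fun is_negative :: "'e vertex \<Rightarrow> bool" where
  "is_negative (Crossing k nw ne sw se) \<longleftrightarrow> k = Negative"
| "is_negative (Mark a b) \<longleftrightarrow> False"

definition positives :: "diagram \<Rightarrow> diagram" where
  "positives K = {v \<in> K. is_positive v}"

definition negatives :: "diagram \<Rightarrow> diagram" where
  "negatives K = {v \<in> K. is_negative v}"

text \<open>
  Replacements of a crossing: the smoothing along the orientation, the smoothing against the
  orientation, and the virtual crossing.
\<close>

datatype choice = Along | Against | Through

definition states :: "diagram \<Rightarrow> (nat vertex \<Rightarrow> choice) set" where
  "states K = (positives K \<union> negatives K) \<rightarrow>\<^sub>E UNIV"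

fun join :: "choice \<Rightarrow> 'e \<Rightarrow> 'e \<Rightarrow> 'e \<Rightarrow> 'e \<Rightarrow> ('e \<times> 'e) set" where
  "join Along nw ne sw se = {(nw, sw), (ne, se)}"
| "join Against nw ne sw se = {(nw, ne), (sw, se)}"
| "join Through nw ne sw se = {(nw, se), (ne, sw)}"

fun joins :: "('e vertex \<Rightarrow> choice) \<Rightarrow> 'e vertex \<Rightarrow> ('e \<times> 'e) set" where
  "joins S (Mark a b) = {(a, b)}"
| "joins S (Crossing k nw ne sw se) =
     join (if k = Virtual then Through else S (Crossing k nw ne sw se)) nw ne sw se"

text \<open>
  The closed curves of the diagram resulting from a state: maximal sets of edges connected
  end to end.
\<close>

definition closed_curves :: "diagram \<Rightarrow> (nat vertex \<Rightarrow> choice) \<Rightarrow> nat set set" where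
  "closed_curves K S = classes (edges K) (\<Union>v\<in>K. joins S v)"

fun color_pair :: "('e \<Rightarrow> 'x) \<Rightarrow> 'e vertex \<Rightarrow> 'x \<times> 'x" where
  "color_pair \<phi> (Crossing Positive nw ne sw se) = (\<phi> nw, \<phi> sw)"
| "color_pair \<phi> (Crossing Negative nw ne sw se) = (\<phi> sw, \<phi> nw)"

definition pick :: "choice \<Rightarrow> 'a \<Rightarrow> 'a \<Rightarrow> 'a \<Rightarrow> 'a" where
  "pick s along against through =
     (case s of Along \<Rightarrow> along | Against \<Rightarrow> against | Through \<Rightarrow> through)"

definition state_value ::
  "('x \<Rightarrow> 'x \<Rightarrow> 'r) \<Rightarrow> ('x \<Rightarrow> 'x \<Rightarrow> 'r) \<Rightarrow> ('x \<Rightarrow> 'x \<Rightarrow> 'r) \<Rightarrow>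
   ('x \<Rightarrow> 'x \<Rightarrow> 'r) \<Rightarrow> ('x \<Rightarrow> 'x \<Rightarrow> 'r) \<Rightarrow> ('x \<Rightarrow> 'x \<Rightarrow> 'r) \<Rightarrow> 'r \<Rightarrow> 'r \<Rightarrow> 'r \<Rightarrow>
   diagram \<Rightarrow> (nat \<Rightarrow> 'x) \<Rightarrow> (nat vertex \<Rightarrow> choice) \<Rightarrow> 'r::{comm_ring, comm_monoid_mult}" where
  "state_value A B C D U V \<delta> w w' K \<phi> S =
     (\<Prod>v\<in>positives K. case_prod (pick (S v) A B V) (color_pair \<phi> v)) *
     (\<Prod>v\<in>negatives K. case_prod (pick (S v) C D U) (color_pair \<phi> v)) *
     \<delta> ^ card (closed_curves K S) *
     (w ^ card (negatives K) * w' ^ card (positives K))"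

definition state_sum ::
  "('x \<Rightarrow> 'x \<Rightarrow> 'r) \<Rightarrow> ('x \<Rightarrow> 'x \<Rightarrow> 'r) \<Rightarrow> ('x \<Rightarrow> 'x \<Rightarrow> 'r) \<Rightarrow>
   ('x \<Rightarrow> 'x \<Rightarrow> 'r) \<Rightarrow> ('x \<Rightarrow> 'x \<Rightarrow> 'r) \<Rightarrow> ('x \<Rightarrow> 'x \<Rightarrow> 'r) \<Rightarrow> 'r \<Rightarrow> 'r \<Rightarrow> 'r \<Rightarrow>
   diagram \<Rightarrow> (nat \<Rightarrow> 'x) \<Rightarrow> 'r::{comm_ring, comm_monoid_mult}" where
  "state_sum A B C D U V \<delta> w w' K \<phi> =
     (\<Sum>S\<in>states K. state_value A B C D U V \<delta> w w' K \<phi> S)"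

text \<open>
  Equality of the multisets $\{f(x) \mid x \in X\}$ and $\{g(y) \mid y \in Y\}$ over index sets
  that may be infinite: every value has the same multiplicity, as a cardinal number.
\<close>

definition same_multiset :: "'a set \<Rightarrow> ('a \<Rightarrow> 'r) \<Rightarrow> 'b set \<Rightarrow> ('b \<Rightarrow> 'r) \<Rightarrow> bool" where
  "same_multiset X f Y g \<longleftrightarrow> (\<forall>r. {x \<in> X. f x = r} \<approx> {y \<in> Y. g y = r})"

lemma same_multiset_finite:
  assumes "finite X" "finite Y"
  shows "same_multiset X f Y g \<longleftrightarrow> image_mset f (mset_set X) = image_mset g (mset_set Y)"
proof -
  have count: "count (image_mset h (mset_set Z)) r = card {z \<in> Z. h z = r}" if "finite Z"
    for Z :: "'z set" and h :: "'z \<Rightarrow> 'c" and r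
    using that by (simp add: count_image_mset' eq_commute[of r])
  show ?thesis
    using assms by (simp add: same_multiset_def multiset_eq_iff count eqpoll_iff_card)
qed

end

theory Submission
  imports Defs
begin

text \<open>
  Resolving the crossings inside the disk of a move writes the state sum as a combination of
  state sums in which the disk is replaced by a pairing of its ends.  For the moves I and II and
  for the move III with all strands directed downward and all crossings positive, the coefficients
  of each pairing agree by the axioms (i), (ii) and (iii) of a bracket, respectively; the
  axioms of a biquandle give the bijection of colorings.  For move I one needs that $x^y = y_x$
  implies $x = y$: the first exchange law gives $(x^y)^{x^y} = (x^x)^{y_x}$, so that
  $x^y = x^x = x_x$ and hence $y_x = x_x$.

  All other versions of the third move are obtained from a single one by two operations.  Composing
  both sides with the inverse of the crossing of the first two strands exchanges these strands;
  this uses the second move.  Turning the picture by a sixth of a full turn replaces the strands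
  1, 2, 3 by 2, 3 and the reverse of 1.  Together the operations generate all orders of the
  strands and all directions.  The same applies to the moves vIII and v.
\<close>

section \<open>Connectivity classes\<close>

text \<open>The obstacle is that the operations generating the third moves pass through many
  intermediate pictures, each of which would have to be shown to be a diagram, and that a diagram is
  a set, in which equal vertices merge. All local work is therefore done with \<open>sim\<close>,
  which compares arbitrary finite lists of vertices: a bracket makes sense as soon as it is known
  which edges exist and which are joined, and a list keeps equal vertices apart. Well-formedness
  enters only when a move of diagrams is translated into \<open>sim\<close>, where it keeps vertices
  from merging.

  The shape of the axioms comes from counting pairings. Six ends have fifteen pairings, one for each
  equation of (iii), and the 27 states of three crossings distribute over them. Four ends have three
  pairings; in (ii) the pairing by two uncrossed strands gets the coefficient 1 and the other two
  get 0. Parallel and antiparallel strands differ in which smoothing keeps the strands apart, so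
  (ii) is used once as it is and once with A, C and B, D exchanged.\<close>

definition link :: "'a \<Rightarrow> 'a \<Rightarrow> ('a \<times> 'a) set \<Rightarrow> ('a \<times> 'a) set" where
  "link x y G = insert (x, y) (insert (y, x) G)"

text \<open>Pairs are stored in both orders so that symmetry becomes an equation. Ordered rewriting
  with it and \<open>link_left_commute\<close> brings every collection of links into a normal form,
  so that equal pairings yield identical brackets.\<close>

lemma link_commute: "link x y G = link y x G"
  by (auto simp: link_def)

lemma link_left_commute: "link x y (link u v G) = link u v (link x y G)"
  by (auto simp: link_def)

lemma map_prod_link: "map_prod f f ` link x y G = link (f x) (f y) (map_prod f f ` G)"
  by (auto simp: link_def)

lemma Field_link [simp]: "Field (link x y G) = insert x (insert y (Field G))"
  by (auto simp: link_def Field_def)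

lemma equiv_conn: "equiv UNIV ((G \<union> G\<inverse>)\<^sup>*)"
  by (simp add: equiv_def refl_rtrancl trans_rtrancl sym_rtrancl sym_Un_converse)

lemma classes_image: "classes N G = (\<lambda>x. (G \<union> G\<inverse>)\<^sup>* `` {x}) ` N"
  by (auto simp: classes_def quotient_def)

text \<open>Sending \<open>g x\<close> to \<open>h x\<close> is well defined and injective because
  both maps identify the same points.\<close>

lemma card_image_cong_kernel:
  assumes "\<And>x y. x \<in> N \<Longrightarrow> y \<in> N \<Longrightarrow> g x = g y \<longleftrightarrow> h x = h y"
  shows "card (g ` N) = card (h ` N)"
proof -
  have *: "h (inv_into N g (g x)) = h x" if "x \<in> N" for x
    using assms[of "inv_into N g (g x)" x] that by (simp add: f_inv_into_f inv_into_into)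
  have "inj_on (\<lambda>c. h (inv_into N g c)) (g ` N)"
    by (rule inj_onI) (auto simp: * assms)
  moreover have "(\<lambda>c. h (inv_into N g c)) ` g ` N = h ` N"
    by (simp add: image_image * cong: image_cong)
  ultimately show ?thesis
    by (metis card_image)
qed

text \<open>Points are glued only if a path joins them already, so no two components merge.\<close>

lemma card_classes_map:
  assumes G: "Field G \<subseteq> N"
    and ker: "\<And>x y. x \<in> N \<Longrightarrow> y \<in> N \<Longrightarrow> f x = f y \<Longrightarrow> (x, y) \<in> (G \<union> G\<inverse>)\<^sup>*"
  shows "card (classes (f ` N) (map_prod f f ` G)) = card (classes N G)"
proof -
  let ?G' = "map_prod f f ` G"
  have lift: "(f x, f y) \<in> (?G' \<union> ?G'\<inverse>)\<^sup>*" if "(x, y) \<in> (G \<union> G\<inverse>)\<^sup>*" for x y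
    using that
  proof induction
    case (step y z)
    then have "(f y, f z) \<in> ?G' \<union> ?G'\<inverse>"
      by force
    with step.IH show ?case
      by (rule rtrancl_into_rtrancl)
  qed simp
  \<comment> \<open>The edges of a path in the image lift one by one, but consecutive lifts may end
    and start at different preimages of the same point; \<open>ker\<close> bridges these gaps. The
    endpoint \<open>y\<close> is generalized for this reason.\<close>
  have down: "(x, y) \<in> (G \<union> G\<inverse>)\<^sup>*"
    if "(f x, z) \<in> (?G' \<union> ?G'\<inverse>)\<^sup>*" "x \<in> N" "y \<in> N" "z = f y" for x y z
    using that
  proof (induction arbitrary: y)
    case base
    then show ?case by (auto intro: ker)
  next
    case (step z z')
    from step.hyps(2) obtain u v where uv: "(u, v) \<in> G \<union> G\<inverse>" "z = f u" "z' = f v"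
      by auto
    with G have "u \<in> N" "v \<in> N" by (auto simp: Field_def)
    then have "(x, u) \<in> (G \<union> G\<inverse>)\<^sup>*" "(v, y) \<in> (G \<union> G\<inverse>)\<^sup>*"
      using step.IH step.prems uv ker by auto
    with uv(1) show ?case
      by (meson rtrancl.rtrancl_into_rtrancl rtrancl_trans)
  qed
  have *: "H `` {x} = H `` {y} \<longleftrightarrow> (x, y) \<in> H" if "H = (F \<union> F\<inverse>)\<^sup>*" for H F and x y :: 'z
    using eq_equiv_class_iff[OF equiv_conn, of x y F] that by simp
  show ?thesis
    unfolding classes_image image_image
    by (rule card_image_cong_kernel) (auto simp: * intro: lift down)
qed

text \<open>A point without links is a component by itself: a closed curve that has split off. This
  is the source of the factor \<delta> in \<open>bracket_loop\<close>.\<close>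

lemma card_classes_loop:
  assumes "Field G \<subseteq> N" "p \<notin> N" "finite N"
  shows "card (classes (insert p N) G) = Suc (card (classes N G))"
proof -
  let ?H = "(G \<union> G\<inverse>)\<^sup>*"
  have "?H `` {p} = {p}"
  proof -
    have "z = p" if "(p, z) \<in> ?H" for z
      using that assms by (induction) (auto simp: Field_def)
    then show ?thesis by auto
  qed
  moreover have "{p} \<notin> (\<lambda>x. ?H `` {x}) ` N"
    using assms(2) by auto
  ultimately show ?thesis
    using assms(3) by (simp add: classes_image)
qed

lemma classes_link_refl: "classes N (link x x G) = classes N G"
proof -
  have "(link x x G \<union> (link x x G)\<inverse>)\<^sup>* = ((G \<union> G\<inverse>) \<union> {(x, x)})\<^sup>*"
    by (rule arg_cong[where f = rtrancl]) (auto simp: link_def)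
  also have "\<dots> = (G \<union> G\<inverse>)\<^sup>*"
    by (rule antisym[OF rtrancl_subset_rtrancl rtrancl_mono]) auto
  finally show ?thesis
    by (simp add: classes_def)
qed

section \<open>The bracket of a list of vertices\<close>

text \<open>The bijection is given by a relation because colorings before and after a move
  correspond by agreeing outside the disk, while the colors inside may exist only by invertibility,
  without a formula.\<close>

lemma same_multisetI:
  assumes "\<And>x. x \<in> X \<Longrightarrow> \<exists>y\<in>Y. Q x y" "\<And>y. y \<in> Y \<Longrightarrow> \<exists>x\<in>X. Q x y"
    and "\<And>x y y'. x \<in> X \<Longrightarrow> y \<in> Y \<Longrightarrow> y' \<in> Y \<Longrightarrow> Q x y \<Longrightarrow> Q x y' \<Longrightarrow> y = y'"
    and "\<And>x x' y. x \<in> X \<Longrightarrow> x' \<in> X \<Longrightarrow> y \<in> Y \<Longrightarrow> Q x y \<Longrightarrow> Q x' y \<Longrightarrow> x = x'"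
    and "\<And>x y. x \<in> X \<Longrightarrow> y \<in> Y \<Longrightarrow> Q x y \<Longrightarrow> f x = g y"
  shows "same_multiset X f Y g"
  unfolding same_multiset_def
proof
  fix r
  obtain h where h: "\<And>x. x \<in> X \<Longrightarrow> h x \<in> Y \<and> Q x (h x)"
    using assms(1) by metis
  have "bij_betw h {x \<in> X. f x = r} {y \<in> Y. g y = r}"
  proof (rule bij_betwI')
    show "h x = h y \<longleftrightarrow> x = y" if "x \<in> {x \<in> X. f x = r}" "y \<in> {x \<in> X. f x = r}" for x y
      using that h assms(4) by (metis mem_Collect_eq)
    show "h x \<in> {y \<in> Y. g y = r}" if "x \<in> {x \<in> X. f x = r}" for x
      using that h assms(5) by force
    show "\<exists>x\<in>{x \<in> X. f x = r}. y = h x" if "y \<in> {y \<in> Y. g y = r}" for y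
    proof -
      from that assms(2) obtain x where "x \<in> X" "Q x y" by auto
      with that h assms(3,5) show ?thesis
        by (intro bexI[of _ x]) auto
    qed
  qed
  then show "{x \<in> X. f x = r} \<approx> {y \<in> Y. g y = r}"
    unfolding eqpoll_def by blast
qed

lemma same_multiset_refl: "same_multiset X f X f"
  by (simp add: same_multiset_def)

lemma same_multiset_sym: "same_multiset X f Y g \<Longrightarrow> same_multiset Y g X f"
  by (simp add: same_multiset_def eqpoll_sym)

lemma same_multiset_trans:
  "same_multiset X f Y g \<Longrightarrow> same_multiset Y g Z h \<Longrightarrow> same_multiset X f Z h"
  unfolding same_multiset_def by (blast intro: eqpoll_trans)

section \<open>Edges, joins and colors under renaming\<close>

abbreviation list_edges :: "nat vertex list \<Rightarrow> nat set" where
  "list_edges vs \<equiv> edges (set vs)"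

lemma edges_simps [simp]:
  "edges {} = {}" "edges (insert v K) = set_vertex v \<union> edges K"
  "edges (K \<union> L) = edges K \<union> edges L"
  by (auto simp: edges_def)

lemma finite_list_edges [simp]: "finite (list_edges vs)"
proof -
  have "finite (set_vertex v)" for v :: "nat vertex"
    by (cases v) auto
  then show ?thesis by (simp add: edges_def)
qed

lemma edges_map_vertex: "edges (map_vertex f ` K) = f ` edges K"
  by (auto simp: edges_def vertex.set_map)

lemma joins_const: "joins S v = joins (\<lambda>_. S v) v"
  by (cases v) auto

lemma joins_map_vertex: "joins (\<lambda>_. s) (map_vertex f v) = map_prod f f ` joins (\<lambda>_. s) v"
  by (cases v; cases s) auto

lemma joins_subset: "Field (joins S v) \<subseteq> set_vertex v"
proof (cases v)
  case (Crossing k nw ne sw se)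
  then show ?thesis by (cases "S v"; cases "k = Virtual") auto
qed auto

lemma converse_insert: "(insert (x, y) G)\<inverse> = insert (y, x) (G\<inverse>)"
  by auto

lemma UNIV_choice: "UNIV = {Along, Against, Through}"
  using choice.nchotomy by auto

lemma finite_choice [simp]: "finite (X :: choice set)"
  by (rule finite_subset[OF subset_UNIV]) (simp add: UNIV_choice)

lemma is_map_vertex [simp]:
  "is_positive (map_vertex f v) = is_positive v" "is_negative (map_vertex f v) = is_negative v"
  by (cases v; simp)+

lemma colored_cong:
  assumes "\<And>e. e \<in> set_vertex v \<Longrightarrow> \<phi> e = \<psi> e"
  shows "colored utri otri \<phi> v \<longleftrightarrow> colored utri otri \<psi> v"
proof (cases v)
  case (Crossing k nw ne sw se)
  with assms show ?thesis by (cases k) auto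
qed (use assms in auto)

lemma colored_map_vertex:
  "colored utri otri \<phi> (map_vertex f v) \<longleftrightarrow> colored utri otri (\<phi> \<circ> f) v"
proof (cases v)
  case (Crossing k nw ne sw se)
  then show ?thesis by (cases k) auto
qed auto

section \<open>The recursive bracket and the state sum\<close>

context biquandle_virtual_bracket
begin

text \<open>The normalization $w^{n-p}$ is spread over the crossings, \<open>w'\<close> for each
  positive and \<open>w\<close> for each negative one. All weights are then local, and a move
  changes only those in its disk.\<close>

definition coef :: "(nat \<Rightarrow> 'x) \<Rightarrow> nat vertex \<Rightarrow> choice \<Rightarrow> 'r" where
  "coef \<phi> v s =
     (if is_positive v then w' * case_prod (pick s A B V) (color_pair \<phi> v)
      else if is_negative v then w * case_prod (pick s C D U) (color_pair \<phi> v) else 1)"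

text \<open>A mark or a virtual crossing contributes a single term. \<open>Through\<close> is a
  placeholder there, since \<open>joins\<close> does not consult the choice at such a
  vertex.\<close>

definition options :: "nat vertex \<Rightarrow> choice set" where
  "options v = (if is_positive v \<or> is_negative v then UNIV else {Through})"

text \<open>
  The bracket of a list of vertices is defined whether or not the list forms a diagram, so that
  moves can be composed without checking well-formedness in between.  \<open>G\<close> collects the ends
  joined so far.
\<close>

primrec bracket :: "nat set \<Rightarrow> (nat \<Rightarrow> 'x) \<Rightarrow> nat vertex list \<Rightarrow> (nat \<times> nat) set \<Rightarrow> 'r" where
  "bracket N \<phi> [] G = \<delta> ^ card (classes N G)"
| "bracket N \<phi> (v # vs) G =
     (\<Sum>s\<in>options v. coef \<phi> v s *
        bracket N \<phi> vs (joins (\<lambda>_. s) v \<union> (joins (\<lambda>_. s) v)\<inverse> \<union> G))"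

lemma bracket_Mark [simp]:
  "bracket N \<phi> (Mark a b # vs) G = bracket N \<phi> vs (link a b G)"
  by (simp add: options_def coef_def link_def insert_commute converse_insert)

lemma bracket_Virtual [simp]:
  "bracket N \<phi> (Crossing Virtual a b c d # vs) G = bracket N \<phi> vs (link a d (link b c G))"
  by (simp add: options_def coef_def link_def insert_commute converse_insert)

lemma bracket_Positive [simp]:
  "bracket N \<phi> (Crossing Positive a b c d # vs) G =
     w' * (A (\<phi> a) (\<phi> c) * bracket N \<phi> vs (link a c (link b d G)) +
           B (\<phi> a) (\<phi> c) * bracket N \<phi> vs (link a b (link c d G)) +
           V (\<phi> a) (\<phi> c) * bracket N \<phi> vs (link a d (link b c G)))"
  by (simp add: options_def coef_def link_def insert_commute converse_insert UNIV_choice pick_def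
      distrib_left mult.assoc add.assoc)

lemma bracket_Negative [simp]:
  "bracket N \<phi> (Crossing Negative a b c d # vs) G =
     w * (C (\<phi> c) (\<phi> a) * bracket N \<phi> vs (link a c (link b d G)) +
          D (\<phi> c) (\<phi> a) * bracket N \<phi> vs (link a b (link c d G)) +
          U (\<phi> c) (\<phi> a) * bracket N \<phi> vs (link a d (link b c G)))"
  by (simp add: options_def coef_def link_def insert_commute converse_insert UNIV_choice pick_def
      distrib_left mult.assoc add.assoc)

declare bracket.simps(2) [simp del]

lemma coef_cong:
  assumes "\<And>e. e \<in> set_vertex v \<Longrightarrow> \<phi> e = \<psi> e"
  shows "coef \<phi> v s = coef \<psi> v s"
proof (cases v)
  case (Crossing k nw ne sw se)
  with assms show ?thesis by (cases k) (auto simp: coef_def)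
qed (auto simp: coef_def)

lemma coef_map_vertex: "coef \<phi> (map_vertex f v) s = coef (\<phi> \<circ> f) v s"
proof (cases v)
  case (Crossing k nw ne sw se)
  then show ?thesis by (cases k) (auto simp: coef_def)
qed (auto simp: coef_def)

lemma bracket_cong:
  assumes "\<And>e. e \<in> list_edges vs \<Longrightarrow> \<phi> e = \<psi> e"
  shows "bracket N \<phi> vs G = bracket N \<psi> vs G"
  using assms
proof (induction vs arbitrary: G)
  case (Cons v vs)
  then show ?case
    unfolding bracket.simps by (intro sum.cong refl arg_cong2[of _ _ _ _ "(*)"] coef_cong) auto
qed simp

text \<open>In each state this is \<open>card_classes_map\<close>. The condition on \<open>f\<close>
  survives the induction because the set of links only grows. It admits injective renamings as well
  as the gluing of two edges that are linked.\<close>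

lemma bracket_map:
  assumes "list_edges vs \<subseteq> N" "Field G \<subseteq> N"
    and "\<And>x y. x \<in> N \<Longrightarrow> y \<in> N \<Longrightarrow> f x = f y \<Longrightarrow> (x, y) \<in> (G \<union> G\<inverse>)\<^sup>*"
  shows "bracket (f ` N) \<phi> (map (map_vertex f) vs) (map_prod f f ` G) = bracket N (\<phi> \<circ> f) vs G"
  using assms
proof (induction vs arbitrary: G)
  case Nil
  then show ?case by (simp add: card_classes_map)
next
  case (Cons v vs)
  have "bracket (f ` N) \<phi> (map (map_vertex f) vs)
          (map_prod f f ` (joins (\<lambda>_. s) v \<union> (joins (\<lambda>_. s) v)\<inverse> \<union> G))
      = bracket N (\<phi> \<circ> f) vs (joins (\<lambda>_. s) v \<union> (joins (\<lambda>_. s) v)\<inverse> \<union> G)" (is "?P s") for s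
  proof (rule Cons.IH)
    let ?H = "joins (\<lambda>_. s) v \<union> (joins (\<lambda>_. s) v)\<inverse> \<union> G"
    show "list_edges vs \<subseteq> N" using Cons.prems(1) by simp
    show "Field ?H \<subseteq> N"
      using joins_subset[of "\<lambda>_. s" v] Cons.prems(1,2) by auto
    show "(x, y) \<in> (?H \<union> ?H\<inverse>)\<^sup>*" if "x \<in> N" "y \<in> N" "f x = f y" for x y
      using Cons.prems(3)[OF that] rtrancl_mono[of "G \<union> G\<inverse>" "?H \<union> ?H\<inverse>"] by auto
  qed
  moreover have "map_prod f f ` (joins (\<lambda>_. s) v \<union> (joins (\<lambda>_. s) v)\<inverse> \<union> G) =
     joins (\<lambda>_. s) (map_vertex f v) \<union> (joins (\<lambda>_. s) (map_vertex f v))\<inverse> \<union> map_prod f f ` G" for s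
    unfolding joins_map_vertex by force
  ultimately show ?case
    by (simp only: list.map bracket.simps(2) coef_map_vertex options_def is_map_vertex)
qed

lemma bracket_link_refl: "bracket N \<phi> vs (link x x G) = bracket N \<phi> vs G"
proof (induction vs arbitrary: G)
  case Nil
  then show ?case by (simp add: classes_link_refl)
next
  case (Cons v vs)
  have "H \<union> link x x G = link x x (H \<union> G)" for H
    by (auto simp: link_def)
  then show ?case by (simp add: bracket.simps(2) Cons.IH)
qed

text \<open>Neither the links nor the remaining vertices touch \<open>p\<close>, so it is one extra
  closed curve in every state.\<close>

lemma bracket_loop:
  assumes "Field G \<subseteq> N" "p \<notin> N" "finite N" "list_edges vs \<subseteq> N"
  shows "bracket (insert p N) \<phi> vs G = \<delta> * bracket N \<phi> vs G"
  using assms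
proof (induction vs arbitrary: G)
  case Nil
  then show ?case by (simp add: card_classes_loop)
next
  case (Cons v vs)
  have "Field (joins (\<lambda>_. s) v \<union> (joins (\<lambda>_. s) v)\<inverse> \<union> G) \<subseteq> N" for s
    using joins_subset[of "\<lambda>_. s" v] Cons.prems(1,4) by auto
  with Cons show ?case
    by (simp add: bracket.simps(2) sum_distrib_left mult.left_commute)
qed

lemma bracket_swap: "bracket N \<phi> (u # v # vs) G = bracket N \<phi> (v # u # vs) G"
proof -
  have "bracket N \<phi> (u # v # vs) G =
     (\<Sum>s\<in>options u. \<Sum>t\<in>options v. coef \<phi> u s * (coef \<phi> v t * bracket N \<phi> vs
       (joins (\<lambda>_. t) v \<union> (joins (\<lambda>_. t) v)\<inverse> \<union> (joins (\<lambda>_. s) u \<union> (joins (\<lambda>_. s) u)\<inverse> \<union> G))))"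
    by (simp add: bracket.simps(2) sum_distrib_left)
  also have "\<dots> = (\<Sum>t\<in>options v. \<Sum>s\<in>options u. coef \<phi> v t * (coef \<phi> u s * bracket N \<phi> vs
       (joins (\<lambda>_. s) u \<union> (joins (\<lambda>_. s) u)\<inverse> \<union> (joins (\<lambda>_. t) v \<union> (joins (\<lambda>_. t) v)\<inverse> \<union> G))))"
    by (subst sum.swap) (simp add: mult.left_commute Un_ac)
  also have "\<dots> = bracket N \<phi> (v # u # vs) G"
    by (simp add: bracket.simps(2) sum_distrib_left)
  finally show ?thesis .
qed

lemma bracket_move_front: "bracket N \<phi> (us @ v # vs) G = bracket N \<phi> (v # us @ vs) G"
proof (induction us arbitrary: G)
  case (Cons u us)
  have "bracket N \<phi> (u # us @ v # vs) G = bracket N \<phi> (u # v # us @ vs) G"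
    unfolding bracket.simps(2)[of _ _ u] Cons.IH ..
  then show ?case by (simp only: append_Cons bracket_swap[of _ _ v u])
qed simp

text \<open>This permits moving the vertices of a disk to the front, where the bracket can be
  expanded.\<close>

lemma bracket_mset:
  assumes "mset us = mset vs"
  shows "bracket N \<phi> us G = bracket N \<phi> vs G"
  using assms
proof (induction us arbitrary: vs G)
  case (Cons u us)
  then have "u \<in> set vs"
    by (metis list.set_intros(1) set_mset_mset)
  then obtain xs ys where vs: "vs = xs @ u # ys"
    by (meson split_list)
  with Cons.prems have "mset us = mset (xs @ ys)" by simp
  then show ?case
    unfolding vs bracket_move_front bracket.simps(2)[of _ _ u] by (simp only: Cons.IH)
qed simp

text \<open>Unfolding the recursion chooses a replacement for each entry of the list, whereas a
  state chooses one for each vertex; for a list without repetitions this is the same.\<close>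

lemma bracket_states:
  assumes "distinct vs"
  defines "X \<equiv> \<lambda>vs. {v \<in> set vs. is_positive v \<or> is_negative v}"
  shows "bracket N \<phi> vs G =
    (\<Sum>S\<in>X vs \<rightarrow>\<^sub>E UNIV. (\<Prod>v\<in>X vs. coef \<phi> v (S v)) *
       \<delta> ^ card (classes N (G \<union> (\<Union>v\<in>set vs. joins S v))))"
  using assms(1)
proof (induction vs arbitrary: G)
  case Nil
  then show ?case by (simp add: X_def)
next
  case (Cons v vs)
  let ?J = "\<lambda>s. joins (\<lambda>_. s) v \<union> (joins (\<lambda>_. s) v)\<inverse> \<union> G"
  have fin: "finite (X vs)" by (simp add: X_def)
  \<comment> \<open>The bracket adds the converse of each join, but the classes are formed from the
    symmetric closure anyway.\<close>
  have cl: "classes N (?J s \<union> H) = classes N (G \<union> (joins (\<lambda>_. s) v \<union> H))" for s H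
    unfolding classes_def
    by (rule arg_cong[where f = "\<lambda>r. N // r\<^sup>*"]) auto
  have IH: "bracket N \<phi> vs (?J s) = (\<Sum>S\<in>X vs \<rightarrow>\<^sub>E UNIV. (\<Prod>v\<in>X vs. coef \<phi> v (S v)) *
       \<delta> ^ card (classes N (G \<union> (joins (\<lambda>_. s) v \<union> (\<Union>v\<in>set vs. joins S v)))))" for s
    using Cons by (simp add: cl)
  show ?case
  proof (cases "is_positive v \<or> is_negative v")
    case False
    then have "X (v # vs) = X vs" by (auto simp: X_def)
    moreover from False have "joins S v = joins (\<lambda>_. Through) v" for S
    proof (cases v)
      case (Crossing k nw ne sw se)
      with False show ?thesis by (cases k) auto
    qed auto
    then have "(\<Union>u\<in>set (v # vs). joins S u) =
        joins (\<lambda>_. Through) v \<union> (\<Union>u\<in>set vs. joins S u)" for S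
      unfolding list.simps UN_insert by (metis (no_types))
    moreover have "coef \<phi> v s = 1" for s
      using False by (simp add: coef_def)
    ultimately show ?thesis
      using False by (simp only: bracket.simps(2) options_def IH) simp
  next
    case True
    then have X: "X (v # vs) = insert v (X vs)" by (auto simp: X_def)
    have v: "v \<notin> X vs" using Cons.prems by (auto simp: X_def)
    \<comment> \<open>A state of the longer list is a state of the shorter one updated at
      \<open>v\<close>. The update does not affect the other vertices because \<open>v\<close> does
      not occur among them.\<close>
    have upd: "(\<Prod>u\<in>insert v (X vs). coef \<phi> u ((S(v := s)) u)) *
         \<delta> ^ card (classes N (G \<union> (\<Union>u\<in>set (v # vs). joins (S(v := s)) u)))
       = coef \<phi> v s * ((\<Prod>u\<in>X vs. coef \<phi> u (S u)) *
         \<delta> ^ card (classes N (G \<union> (joins (\<lambda>_. s) v \<union> (\<Union>u\<in>set vs. joins S u)))))" for S s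
    proof -
      have "joins (S(v := s)) u = joins S u" if "u \<in> set vs" for u
        using that Cons.prems joins_const[of S u] joins_const[of "S(v := s)" u] by auto
      moreover have "joins (S(v := s)) v = joins (\<lambda>_. s) v"
        using joins_const[of "S(v := s)" v] by simp
      moreover have "(\<Prod>u\<in>X vs. coef \<phi> u ((S(v := s)) u)) = (\<Prod>u\<in>X vs. coef \<phi> u (S u))"
        using v by (intro prod.cong) auto
      ultimately show ?thesis
        using v fin by (simp add: mult.assoc)
    qed
    have "bracket N \<phi> (v # vs) G = (\<Sum>s\<in>UNIV. \<Sum>S\<in>X vs \<rightarrow>\<^sub>E UNIV.
        coef \<phi> v s * ((\<Prod>u\<in>X vs. coef \<phi> u (S u)) *
         \<delta> ^ card (classes N (G \<union> (joins (\<lambda>_. s) v \<union> (\<Union>u\<in>set vs. joins S u))))))"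
      using True by (simp add: bracket.simps(2) options_def IH sum_distrib_left)
    also have "\<dots> = (\<Sum>(s, S)\<in>UNIV \<times> (X vs \<rightarrow>\<^sub>E UNIV).
        (\<Prod>u\<in>insert v (X vs). coef \<phi> u ((S(v := s)) u)) *
         \<delta> ^ card (classes N (G \<union> (\<Union>u\<in>set (v # vs). joins (S(v := s)) u))))"
      unfolding upd by (simp add: sum.cartesian_product)
    also have "\<dots> = (\<Sum>S\<in>insert v (X vs) \<rightarrow>\<^sub>E UNIV. (\<Prod>u\<in>insert v (X vs). coef \<phi> u (S u)) *
         \<delta> ^ card (classes N (G \<union> (\<Union>u\<in>set (v # vs). joins S u))))"
      unfolding PiE_insert_eq
      by (subst sum.reindex[OF inj_combinator[OF v]]) (simp add: case_prod_beta')
    finally show ?thesis unfolding X .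
  qed
qed

lemma state_sum_bracket:
  assumes "distinct vs" "set vs = K"
  shows "state_sum A B C D U V \<delta> w w' K \<phi> = bracket (edges K) \<phi> vs {}"
proof -
  have fin: "finite (positives K)" "finite (negatives K)"
    using assms(2) by (auto simp: positives_def negatives_def)
  have split: "{v \<in> set vs. is_positive v \<or> is_negative v} = positives K \<union> negatives K"
    using assms(2) by (auto simp: positives_def negatives_def)
  have disj: "positives K \<inter> negatives K = {}"
  proof -
    have "\<not> (is_positive v \<and> is_negative v)" for v :: "nat vertex"
      by (cases v) auto
    then show ?thesis by (auto simp: positives_def negatives_def)
  qed
  have "(\<Prod>v\<in>positives K. coef \<phi> v (S v)) =
      w' ^ card (positives K) * (\<Prod>v\<in>positives K. case_prod (pick (S v) A B V) (color_pair \<phi> v))" for S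
    unfolding prod_constant[symmetric] prod.distrib[symmetric]
    by (rule prod.cong) (auto simp: coef_def positives_def)
  moreover have "(\<Prod>v\<in>negatives K. coef \<phi> v (S v)) =
      w ^ card (negatives K) * (\<Prod>v\<in>negatives K. case_prod (pick (S v) C D U) (color_pair \<phi> v))" for S
    unfolding prod_constant[symmetric] prod.distrib[symmetric]
    using disj by (intro prod.cong) (auto simp: coef_def positives_def negatives_def)
  ultimately show ?thesis
    unfolding bracket_states[OF assms(1)] split prod.union_disjoint[OF fin disj] state_sum_def
      states_def state_value_def closed_curves_def
    by (simp add: assms(2) ac_simps)
qed

end

section \<open>Eliminating the inner edges of a disk\<close>

definition contract :: "'a \<Rightarrow> 'a \<Rightarrow> ('a \<times> 'a) set \<Rightarrow> ('a \<times> 'a) set" where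
  "contract p x H = map_prod (id(p := x)) (id(p := x)) ` H"

lemma contract_simps [simp]:
  "contract p x {} = {}"
  "contract p x (link u v H) =
     link (if u = p then x else u) (if v = p then x else v) (contract p x H)"
  by (simp_all add: contract_def map_prod_link)

context biquandle_virtual_bracket
begin

lemma bracket_contract:
  assumes "p \<notin> N" "x \<in> N" "Field H \<subseteq> insert p N" "list_edges vs \<subseteq> N"
  shows "bracket (insert p N) \<phi> vs (link p x H) = bracket N \<phi> vs (contract p x H)"
proof -
  let ?f = "id(p := x)"
  have "map_vertex ?f v = v" if "v \<in> set vs" for v
  proof -
    have "?f e = e" if "e \<in> set_vertex v" for e
      using that \<open>v \<in> set vs\<close> assms(1,4) by (auto simp: edges_def)
    then show ?thesis
      by (metis (no_types, lifting) vertex.map_cong vertex.map_ident)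
  qed
  then have "map (map_vertex ?f) vs = vs"
    by (simp add: map_idI)
  moreover have "?f ` insert p N = N"
    using assms(1,2) by auto
  moreover have "map_prod ?f ?f ` link p x H = link x x (contract p x H)"
    by (simp add: map_prod_link contract_def)
  moreover have "bracket (?f ` insert p N) \<phi> (map (map_vertex ?f) vs) (map_prod ?f ?f ` link p x H)
      = bracket (insert p N) (\<phi> \<circ> ?f) vs (link p x H)"
  proof (rule bracket_map)
    fix u v
    assume "u \<in> insert p N" "v \<in> insert p N" "?f u = ?f v"
    then have "u = v \<or> (u, v) \<in> link p x H"
      by (auto simp: link_def split: if_splits)
    then show "(u, v) \<in> (link p x H \<union> (link p x H)\<inverse>)\<^sup>*"
      by auto
  qed (use assms in auto)
  moreover have "bracket (insert p N) (\<phi> \<circ> ?f) vs (link p x H) = bracket (insert p N) \<phi> vs (link p x H)"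
    using assms(1,4) by (intro bracket_cong) auto
  ultimately show ?thesis
    by (simp add: bracket_link_refl)
qed

lemma bracket_contract':
  assumes "p \<notin> N" "x \<in> N" "Field H \<subseteq> insert p N" "list_edges vs \<subseteq> N" "G = link p x H"
  shows "bracket (insert p N) \<phi> vs G = bracket N \<phi> vs (contract p x H)"
  using bracket_contract assms by blast

text \<open>
  The simplifier finds the link to be contracted, or to be dropped, at any of the positions that
  occur when up to three crossings are expanded.
\<close>

lemma contractions:
  fixes N p x \<phi> vs
  assumes "p \<notin> N" "x \<in> N" "list_edges vs \<subseteq> N" "Field H \<subseteq> insert p N"
  defines "P \<equiv> \<lambda>G G'. bracket (insert p N) \<phi> vs G = bracket N \<phi> vs (contract p x G')"
  shows "P (link p x H) H" "P (link x p H) H"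
    and "{u1, v1} \<subseteq> insert p N \<Longrightarrow> P (link u1 v1 (link p x H)) (link u1 v1 H)"
    and "{u1, v1} \<subseteq> insert p N \<Longrightarrow> P (link u1 v1 (link x p H)) (link u1 v1 H)"
    and "{u1, v1, u2, v2} \<subseteq> insert p N \<Longrightarrow>
      P (link u1 v1 (link u2 v2 (link p x H))) (link u1 v1 (link u2 v2 H))"
    and "{u1, v1, u2, v2} \<subseteq> insert p N \<Longrightarrow>
      P (link u1 v1 (link u2 v2 (link x p H))) (link u1 v1 (link u2 v2 H))"
    and "{u1, v1, u2, v2, u3, v3} \<subseteq> insert p N \<Longrightarrow>
      P (link u1 v1 (link u2 v2 (link u3 v3 (link p x H)))) (link u1 v1 (link u2 v2 (link u3 v3 H)))"
    and "{u1, v1, u2, v2, u3, v3} \<subseteq> insert p N \<Longrightarrow>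
      P (link u1 v1 (link u2 v2 (link u3 v3 (link x p H)))) (link u1 v1 (link u2 v2 (link u3 v3 H)))"
    and "{u1, v1, u2, v2, u3, v3, u4, v4} \<subseteq> insert p N \<Longrightarrow>
      P (link u1 v1 (link u2 v2 (link u3 v3 (link u4 v4 (link p x H)))))
        (link u1 v1 (link u2 v2 (link u3 v3 (link u4 v4 H))))"
    and "{u1, v1, u2, v2, u3, v3, u4, v4} \<subseteq> insert p N \<Longrightarrow>
      P (link u1 v1 (link u2 v2 (link u3 v3 (link u4 v4 (link x p H)))))
        (link u1 v1 (link u2 v2 (link u3 v3 (link u4 v4 H))))"
  unfolding P_def using assms(1-4)
  by (intro bracket_contract'; simp add: link_commute[of x p] link_left_commute[of _ _ p x])+

lemma drops:
  "bracket N \<phi> vs (link x x H) = bracket N \<phi> vs H"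
  "bracket N \<phi> vs (link u1 v1 (link x x H)) = bracket N \<phi> vs (link u1 v1 H)"
  "bracket N \<phi> vs (link u1 v1 (link u2 v2 (link x x H))) =
   bracket N \<phi> vs (link u1 v1 (link u2 v2 H))"
  "bracket N \<phi> vs (link u1 v1 (link u2 v2 (link u3 v3 (link x x H)))) =
   bracket N \<phi> vs (link u1 v1 (link u2 v2 (link u3 v3 H)))"
  "bracket N \<phi> vs (link u1 v1 (link u2 v2 (link u3 v3 (link u4 v4 (link x x H))))) =
   bracket N \<phi> vs (link u1 v1 (link u2 v2 (link u3 v3 (link u4 v4 H))))"
  "bracket N \<phi> vs (link u1 v1 (link u2 v2 (link u3 v3 (link u4 v4 (link u5 v5 (link x x H)))))) =
   bracket N \<phi> vs (link u1 v1 (link u2 v2 (link u3 v3 (link u4 v4 (link u5 v5 H)))))"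
  by (simp_all only: link_left_commute[of _ _ x x] bracket_link_refl)

text \<open>An inner edge is contracted into an edge to which it is linked; if it is linked only to
  itself, that link is dropped and the edge is taken out as a closed curve.\<close>

lemmas reduce = contractions drops bracket_loop subset_insertI2

section \<open>Local moves\<close>

abbreviation fits :: "(nat \<Rightarrow> 'x) \<Rightarrow> nat vertex list \<Rightarrow> bool" where
  "fits \<phi> vs \<equiv> \<forall>v\<in>set vs. colored utri otri \<phi> v"

definition sim :: "nat vertex list \<Rightarrow> nat vertex list \<Rightarrow> bool" where
  "sim vs us \<longleftrightarrow> same_multiset
     (colorings utri otri (set vs)) (\<lambda>\<phi>. bracket (list_edges vs) \<phi> vs {})
     (colorings utri otri (set us)) (\<lambda>\<phi>. bracket (list_edges us) \<phi> us {})"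

lemma sim_sym: "sim vs us \<Longrightarrow> sim us vs"
  unfolding sim_def by (rule same_multiset_sym)

lemma sim_trans [trans]: "sim vs us \<Longrightarrow> sim us ts \<Longrightarrow> sim vs ts"
  unfolding sim_def by (rule same_multiset_trans)

lemma sim_mset: "mset vs = mset us \<Longrightarrow> sim vs us"
  by (simp add: sim_def bracket_mset[of vs us] mset_eq_setD[of vs us] same_multiset_refl)

lemma fits_cong:
  assumes "\<And>e. e \<in> list_edges vs \<Longrightarrow> \<phi> e = \<psi> e"
  shows "fits \<phi> vs \<longleftrightarrow> fits \<psi> vs"
  using assms by (intro ball_cong refl colored_cong) (auto simp: edges_def)

text \<open>\<open>E\<close> consists of the ends of the disk, \<open>I1\<close> and
  \<open>I2\<close> of its inner edges on either side. A coloring outside extends over one side if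
  and only if it extends over the other, and each extension is unique; this gives the bijection.
  Only \<open>val\<close> concerns the bracket. There the set of outer edges is an arbitrary
  \<open>N\<close>, so that the verification of a move needs nothing but membership facts.\<close>

lemma local_move:
  assumes T1: "list_edges T1 = E \<union> I1" and T2: "list_edges T2 = E \<union> I2"
    and fresh: "(I1 \<union> I2) \<inter> (E \<union> list_edges R) = {}"
    and ex1: "\<And>\<phi>. fits \<phi> T1 \<Longrightarrow> \<exists>\<psi>. fits \<psi> T2 \<and> (\<forall>e. e \<notin> I1 \<union> I2 \<longrightarrow> \<psi> e = \<phi> e)"
    and ex2: "\<And>\<phi>. fits \<phi> T2 \<Longrightarrow> \<exists>\<psi>. fits \<psi> T1 \<and> (\<forall>e. e \<notin> I1 \<union> I2 \<longrightarrow> \<psi> e = \<phi> e)"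
    and un1: "\<And>\<phi> \<psi>. fits \<phi> T1 \<Longrightarrow> fits \<psi> T1 \<Longrightarrow> \<forall>e\<in>E. \<phi> e = \<psi> e \<Longrightarrow> \<forall>e\<in>I1. \<phi> e = \<psi> e"
    and un2: "\<And>\<phi> \<psi>. fits \<phi> T2 \<Longrightarrow> fits \<psi> T2 \<Longrightarrow> \<forall>e\<in>E. \<phi> e = \<psi> e \<Longrightarrow> \<forall>e\<in>I2. \<phi> e = \<psi> e"
    and val: "\<And>\<phi> \<psi> N. fits \<phi> T1 \<Longrightarrow> fits \<psi> T2 \<Longrightarrow> \<forall>e\<in>E. \<phi> e = \<psi> e \<Longrightarrow> finite N \<Longrightarrow>
      E \<subseteq> N \<Longrightarrow> list_edges R \<subseteq> N \<Longrightarrow> (I1 \<union> I2) \<inter> N = {} \<Longrightarrow>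
      (\<And>G. bracket N \<psi> R G = bracket N \<phi> R G) \<Longrightarrow>
      bracket (I1 \<union> N) \<phi> (T1 @ R) {} = bracket (I2 \<union> N) \<psi> (T2 @ R) {}"
  shows "sim (T1 @ R) (T2 @ R)"
proof -
  let ?N = "E \<union> list_edges R"
  have N: "list_edges (T1 @ R) = I1 \<union> ?N" "list_edges (T2 @ R) = I2 \<union> ?N"
    using T1 T2 by auto
  have transfer: "\<exists>\<psi>'\<in>colorings utri otri (set (T' @ R)). \<forall>e\<in>?N. \<phi> e = \<psi>' e"
    if "\<phi> \<in> colorings utri otri (set (T @ R))" "list_edges T' = E \<union> I'" "I' \<subseteq> I1 \<union> I2"
      and ex: "\<And>\<phi>. fits \<phi> T \<Longrightarrow> \<exists>\<psi>. fits \<psi> T' \<and> (\<forall>e. e \<notin> I1 \<union> I2 \<longrightarrow> \<psi> e = \<phi> e)" for \<phi> T T' I'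
  proof -
    from that(1) have fit: "fits \<phi> T" "fits \<phi> R" by (auto simp: colorings_def)
    from ex[OF fit(1)] obtain \<psi> where \<psi>: "fits \<psi> T'" "\<And>e. e \<notin> I1 \<union> I2 \<Longrightarrow> \<psi> e = \<phi> e"
      by auto
    have agree: "\<phi> e = \<psi> e" if "e \<in> ?N" for e
      using \<psi>(2)[of e] that fresh by (metis IntI emptyE)
    have "fits \<psi> R"
      using fit(2) fits_cong[of R \<phi> \<psi>] agree by auto
    \<comment> \<open>Colorings are extensional, so the extended map is cut down to the edges of the
      new list.\<close>
    with \<psi>(1) have "fits (restrict \<psi> (list_edges (T' @ R))) (T' @ R)"
      using fits_cong[of "T' @ R" \<psi> "restrict \<psi> (list_edges (T' @ R))"] by auto
    then have "restrict \<psi> (list_edges (T' @ R)) \<in> colorings utri otri (set (T' @ R))"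
      by (simp add: colorings_def)
    moreover have "\<forall>e\<in>?N. \<phi> e = restrict \<psi> (list_edges (T' @ R)) e"
      using agree that(2) by auto
    ultimately show ?thesis by blast
  qed
  have unique: "\<phi> = \<psi>"
    if "\<phi> \<in> colorings utri otri (set (T @ R))" "\<psi> \<in> colorings utri otri (set (T @ R))"
      "list_edges T = E \<union> I" "\<forall>e\<in>?N. \<phi> e = \<psi> e"
      and un: "\<And>\<phi> \<psi>. fits \<phi> T \<Longrightarrow> fits \<psi> T \<Longrightarrow> \<forall>e\<in>E. \<phi> e = \<psi> e \<Longrightarrow> \<forall>e\<in>I. \<phi> e = \<psi> e"
    for \<phi> \<psi> T I
  proof (rule extensionalityI)
    from that show "\<phi> \<in> extensional (I \<union> ?N)" "\<psi> \<in> extensional (I \<union> ?N)"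
      by (auto simp: colorings_def Un_ac)
    have "\<forall>e\<in>I. \<phi> e = \<psi> e"
      by (rule un) (use that in \<open>auto simp: colorings_def\<close>)
    then show "\<phi> e = \<psi> e" if "e \<in> I \<union> ?N" for e
      using that \<open>\<forall>e\<in>?N. \<phi> e = \<psi> e\<close> by auto
  qed
  show ?thesis
    unfolding sim_def
  proof (rule same_multisetI[where Q = "\<lambda>\<phi> \<psi>. \<forall>e\<in>?N. \<phi> e = \<psi> e"])
    fix \<phi> assume "\<phi> \<in> colorings utri otri (set (T1 @ R))"
    then show "\<exists>\<psi>\<in>colorings utri otri (set (T2 @ R)). \<forall>e\<in>?N. \<phi> e = \<psi> e"
      by (rule transfer[OF _ T2 _ ex1]) auto
  next
    fix \<psi> assume "\<psi> \<in> colorings utri otri (set (T2 @ R))"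
    then have "\<exists>\<phi>\<in>colorings utri otri (set (T1 @ R)). \<forall>e\<in>?N. \<psi> e = \<phi> e"
      by (rule transfer[OF _ T1 _ ex2]) auto
    then show "\<exists>\<phi>\<in>colorings utri otri (set (T1 @ R)). \<forall>e\<in>?N. \<phi> e = \<psi> e"
      by metis
  next
    fix \<phi> \<psi> \<psi>'
    assume "\<psi> \<in> colorings utri otri (set (T2 @ R))" "\<psi>' \<in> colorings utri otri (set (T2 @ R))"
      and "\<forall>e\<in>?N. \<phi> e = \<psi> e" "\<forall>e\<in>?N. \<phi> e = \<psi>' e"
    then show "\<psi> = \<psi>'"
      by (intro unique[OF _ _ T2 _ un2]) auto
  next
    fix \<phi> \<phi>' \<psi>
    assume "\<phi> \<in> colorings utri otri (set (T1 @ R))" "\<phi>' \<in> colorings utri otri (set (T1 @ R))"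
      and "\<forall>e\<in>?N. \<phi> e = \<psi> e" "\<forall>e\<in>?N. \<phi>' e = \<psi> e"
    then show "\<phi> = \<phi>'"
      by (intro unique[OF _ _ T1 _ un1]) auto
  next
    fix \<phi> \<psi>
    assume "\<phi> \<in> colorings utri otri (set (T1 @ R))" "\<psi> \<in> colorings utri otri (set (T2 @ R))"
      and agree: "\<forall>e\<in>?N. \<phi> e = \<psi> e"
    then have "fits \<phi> T1" "fits \<psi> T2" by (auto simp: colorings_def)
    moreover have "bracket ?N \<psi> R G = bracket ?N \<phi> R G" for G
      using agree by (intro bracket_cong) auto
    moreover have "finite ?N"
      using T1 finite_list_edges[of T1] by simp
    ultimately show "bracket (list_edges (T1 @ R)) \<phi> (T1 @ R) {} =
        bracket (list_edges (T2 @ R)) \<psi> (T2 @ R) {}"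
      unfolding N using agree fresh by (intro val) auto
  qed
qed

text \<open>The map may glue edges, provided that every coloring is constant on the glued ones. A
  coloring \<open>\<phi>\<close> then corresponds to the \<open>\<psi>\<close> with
  \<open>\<phi> = \<psi> \<circ> f\<close> on the edges. Renaming and the removal of marks are both
  of this kind.\<close>

lemma sim_map:
  fixes f :: "nat \<Rightarrow> nat"
  assumes col: "\<And>\<phi> x y. fits \<phi> vs \<Longrightarrow> x \<in> list_edges vs \<Longrightarrow> y \<in> list_edges vs \<Longrightarrow> f x = f y \<Longrightarrow> \<phi> x = \<phi> y"
    and val: "\<And>\<phi>. bracket (f ` list_edges vs) \<phi> (map (map_vertex f) vs) {} =
      bracket (list_edges vs) (\<phi> \<circ> f) vs {}"
  shows "sim vs (map (map_vertex f) vs)"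
proof -
  let ?E = "list_edges vs" and ?us = "map (map_vertex f) vs"
  have us: "list_edges ?us = f ` ?E"
    by (simp add: edges_map_vertex)
  have fit: "fits \<psi> ?us \<longleftrightarrow> fits (\<psi> \<circ> f) vs" for \<psi>
    by (simp add: colored_map_vertex)
  show ?thesis
    unfolding sim_def
  proof (rule same_multisetI[where Q = "\<lambda>\<phi> \<psi>. \<forall>e\<in>?E. \<phi> e = \<psi> (f e)"])
    fix \<phi> assume "\<phi> \<in> colorings utri otri (set vs)"
    then have \<phi>: "fits \<phi> vs" by (simp add: colorings_def)
    \<comment> \<open>By \<open>col\<close> it does not matter which preimage
      \<open>inv_into\<close> picks.\<close>
    let ?\<psi> = "restrict (\<phi> \<circ> inv_into ?E f) (f ` ?E)"
    have *: "\<phi> e = ?\<psi> (f e)" if "e \<in> ?E" for e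
      using that col[OF \<phi>, of e "inv_into ?E f (f e)"] by (simp add: f_inv_into_f inv_into_into)
    then have "fits ?\<psi> ?us"
      unfolding fit using \<phi> fits_cong[of vs \<phi> "?\<psi> \<circ> f"] by auto
    then have "?\<psi> \<in> colorings utri otri (set ?us)"
      using us by (simp add: colorings_def)
    with * show "\<exists>\<psi>\<in>colorings utri otri (set ?us). \<forall>e\<in>?E. \<phi> e = \<psi> (f e)"
      by blast
  next
    fix \<psi> assume "\<psi> \<in> colorings utri otri (set ?us)"
    then have "fits (\<psi> \<circ> f) vs" using fit by (simp add: colorings_def)
    then have "fits (restrict (\<psi> \<circ> f) ?E) vs"
      using fits_cong[of vs "\<psi> \<circ> f" "restrict (\<psi> \<circ> f) ?E"] by auto
    then have "restrict (\<psi> \<circ> f) ?E \<in> colorings utri otri (set vs)"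
      by (simp add: colorings_def)
    then show "\<exists>\<phi>\<in>colorings utri otri (set vs). \<forall>e\<in>?E. \<phi> e = \<psi> (f e)"
      by (rule rev_bexI) simp
  next
    fix \<phi> \<psi> \<psi>'
    assume "\<psi> \<in> colorings utri otri (set ?us)" "\<psi>' \<in> colorings utri otri (set ?us)"
      and "\<forall>e\<in>?E. \<phi> e = \<psi> (f e)" "\<forall>e\<in>?E. \<phi> e = \<psi>' (f e)"
    then show "\<psi> = \<psi>'"
      unfolding colorings_def us by (intro extensionalityI[of _ "f ` ?E"]) auto
  next
    fix \<phi> \<phi>' \<psi>
    assume "\<phi> \<in> colorings utri otri (set vs)" "\<phi>' \<in> colorings utri otri (set vs)"
      and "\<forall>e\<in>?E. \<phi> e = \<psi> (f e)" "\<forall>e\<in>?E. \<phi>' e = \<psi> (f e)"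
    then show "\<phi> = \<phi>'"
      unfolding colorings_def by (intro extensionalityI[of _ ?E]) auto
  next
    fix \<phi> \<psi> :: "nat \<Rightarrow> 'x"
    assume "\<forall>e\<in>?E. \<phi> e = \<psi> (f e)"
    then show "bracket ?E \<phi> vs {} = bracket (list_edges ?us) \<psi> ?us {}"
      unfolding us val by (intro bracket_cong) auto
  qed
qed

lemma sim_rename:
  assumes "inj_on g (list_edges vs)"
  shows "sim vs (map (map_vertex g) vs)"
proof (rule sim_map)
  show "bracket (g ` list_edges vs) \<phi> (map (map_vertex g) vs) {} =
      bracket (list_edges vs) (\<phi> \<circ> g) vs {}" for \<phi>
    using bracket_map[of vs "list_edges vs" "{}" g \<phi>] assms by (auto dest: inj_onD)
qed (use assms in \<open>auto dest: inj_onD\<close>)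

text \<open>The assumption prevents the loss of a circle that consists of \<open>a\<close> alone:
  its color and its factor \<delta> would disappear with the mark.\<close>

lemma sim_Mark_refl:
  assumes "a \<in> list_edges vs"
  shows "sim (Mark a a # vs) vs"
  using assms
  by (simp add: sim_def colorings_def insert_absorb bracket_link_refl same_multiset_refl)

text \<open>Substituting \<open>a\<close> for \<open>b\<close> everywhere, the mark included, is an
  instance of \<open>sim_map\<close>; the mark then joins \<open>a\<close> to itself.\<close>

lemma sim_unmark:
  assumes "a \<noteq> b" "b \<in> list_edges vs"
  shows "sim (Mark a b # vs) (map (map_vertex (id(b := a))) vs)"
proof -
  let ?f = "id(b := a)" and ?us = "Mark a b # vs"
  have "sim ?us (map (map_vertex ?f) ?us)"
  proof (rule sim_map)
    show "\<phi> x = \<phi> y" if "fits \<phi> ?us" "?f x = ?f y" for \<phi> x y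
      using that by (auto split: if_splits)
    have "bracket (?f ` list_edges ?us) \<phi> (map (map_vertex ?f) vs) (map_prod ?f ?f ` link a b {}) =
        bracket (list_edges ?us) (\<phi> \<circ> ?f) vs (link a b {})" for \<phi>
    proof (rule bracket_map)
      fix x y
      assume "?f x = ?f y"
      then have "x = y \<or> (x, y) \<in> link a b {}"
        by (auto simp: link_def split: if_splits)
      then show "(x, y) \<in> (link a b {} \<union> (link a b {})\<inverse>)\<^sup>*"
        by auto
    qed auto
    then show "bracket (?f ` list_edges ?us) \<phi> (map (map_vertex ?f) ?us) {} =
        bracket (list_edges ?us) (\<phi> \<circ> ?f) ?us {}" for \<phi>
      by (simp add: map_prod_link)
  qed
  also have "map (map_vertex ?f) ?us = Mark a a # map (map_vertex ?f) vs"
    using assms(1) by simp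
  also have "sim \<dots> (map (map_vertex ?f) vs)"
    using assms(2) by (intro sim_Mark_refl) (force simp: edges_map_vertex)
  finally show ?thesis .
qed

section \<open>The third move with positive crossings\<close>

lemma alpha_inj: "otri y x = otri y' x \<longleftrightarrow> y = y'"
  using alpha_bij[of x] by (auto dest: bij_is_inj injD)

lemma beta_inj: "utri y x = utri y' x \<longleftrightarrow> y = y'"
  using beta_bij[of x] by (auto dest: bij_is_inj injD)

lemma ex_alpha: "\<exists>y. z = otri y x"
  using alpha_bij[of x] by (metis bij_pointE)

lemma ex_beta: "\<exists>y. z = utri y x"
  using beta_bij[of x] by (metis bij_pointE)

lemma S_inj: "otri y x = otri y' x' \<Longrightarrow> utri x y = utri x' y' \<Longrightarrow> x = x' \<and> y = y'"
  using bij_is_inj[OF S_bij] by (auto dest!: injD[of _ "(x, y)" "(x', y')"])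

lemma ex_S: "\<exists>x y. z = otri y x \<and> t = utri x y"
proof -
  obtain p where "(z, t) = (\<lambda>(x, y). (otri y x, utri x y)) p"
    using bij_is_surj[OF S_bij] by (rule surjE)
  then show ?thesis by (cases p) auto
qed

lemma utri_eq_otri:
  assumes "utri x y = otri y x"
  shows "x = y"
proof -
  have "utri (utri x y) (utri x y) = utri (utri x x) (utri x y)"
    using exchange_uu[of x y x] assms by simp
  then have "utri x y = utri x x"
    by (simp add: beta_inj)
  then have "otri y x = otri x x"
    using assms diagonal by simp
  then show ?thesis
    by (simp add: alpha_inj)
qed

text \<open>A preimage of $(z, z)$ under $S$ has equal components by
  \<open>utri_eq_otri\<close>.\<close>

lemma ex_diagonal: "\<exists>x. z = otri x x"
  using ex_S[of z z] utri_eq_otri by metis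

text \<open>Each \<open>Z\<close> is one pairing of the six ends. The state with coefficients B, A,
  B closes the inner edges to a curve, hence its factor \<delta>.\<close>

lemma bracket_triangle_left:
  assumes "distinct [p, q, r]" "{p, q, r} \<inter> {a, b, c, d, e, f} = {}" "{p, q, r} \<inter> N = {}"
    and "{a, b, c, d, e, f} \<subseteq> N" "finite N" "list_edges R \<subseteq> N"
    and "\<phi> p = y" "\<phi> q = utri (\<phi> a) y" "\<phi> r = otri (\<phi> d) y"
  defines "t \<equiv> \<lambda>P Q T. tri utri otri P Q T (\<phi> a) y (\<phi> d)"
    and "Z \<equiv> \<lambda>x1 x2 y1 y2 z1 z2. bracket N \<phi> R (link x1 x2 (link y1 y2 (link z1 z2 {})))"
  shows "bracket ({p, q, r} \<union> N) \<phi>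
      ([Crossing Positive a b p q, Crossing Positive q c r f, Crossing Positive p r d e] @ R) {} =
    w' * (w' * (w' * (
      (t A A A + t V A V) * Z a d b e c f +
      (t A A B + t B A A + \<delta> * t B A B + t B A V + t B B B + t B V B + t V A B) * Z a b c f d e +
      (t A B A) * Z a d b c e f +
      (t A V A) * Z a d b f c e +
      (t A A V + t V A A) * Z a e b d c f +
      (t B B A + t B V V) * Z a b c d e f +
      (t A B B + t V V B) * Z a f b c d e +
      (t B B V + t B V A) * Z a b c e d f +
      (t A B V) * Z a e b c d f +
      (t V B A) * Z a c b d e f +
      (t A V B + t V B B) * Z a c b f d e +
      (t V V A) * Z a f b d c e +
      (t A V V) * Z a e b f c d +
      (t V B V) * Z a c b e d f +
      (t V V V) * Z a f b e c d)))"
proof -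
  have ne: "p \<noteq> q" "q \<noteq> p" "p \<noteq> r" "r \<noteq> p" "q \<noteq> r" "r \<noteq> q"
    using assms(1) by auto
  have ne': "x \<noteq> p" "x \<noteq> q" "x \<noteq> r" "p \<noteq> x" "q \<noteq> x" "r \<noteq> x" if "x \<in> {a, b, c, d, e, f}" for x
    using assms(2) that by auto
  have N: "p \<notin> N" "q \<notin> N" "r \<notin> N" "a \<in> N" "b \<in> N" "c \<in> N" "d \<in> N" "e \<in> N" "f \<in> N"
    using assms(3,4) by auto
  show ?thesis
    by (simp add: ne ne' N reduce assms(5,6) link_commute link_left_commute Z_def)
      (simp add: assms(7-9) t_def tri_def algebra_simps)
qed

text \<open>The color \<open>y\<close> of the middle edge of strand 2 on the left side need not
  occur on this side. It enters through the colors $y_x$ and $y^z$ at the ends \<open>b\<close> and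
  \<open>e\<close> of that strand, where $x$ and $z$ are the colors of \<open>a\<close> and
  \<open>d\<close>.\<close>

lemma bracket_triangle_right:
  assumes "distinct [p, q, r]" "{p, q, r} \<inter> {a, b, c, d, e, f} = {}" "{p, q, r} \<inter> N = {}"
    and "{a, b, c, d, e, f} \<subseteq> N" "finite N" "list_edges R \<subseteq> N"
    and "\<phi> b = otri y (\<phi> a)" "\<phi> e = utri y (\<phi> d)"
      "\<phi> p = otri (\<phi> d) (\<phi> a)" "\<phi> r = utri (\<phi> a) (\<phi> d)"
  defines "t \<equiv> \<lambda>P Q T. tri' utri otri P Q T (\<phi> a) y (\<phi> d)"
    and "Z \<equiv> \<lambda>x1 x2 y1 y2 z1 z2. bracket N \<phi> R (link x1 x2 (link y1 y2 (link z1 z2 {})))"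
  shows "bracket ({p, q, r} \<union> N) \<phi>
      ([Crossing Positive b c p q, Crossing Positive a p d r, Crossing Positive r q e f] @ R) {} =
    w' * (w' * (w' * (
      (t A A A + t V A V) * Z a d b e c f +
      (t A B A) * Z a b c f d e +
      (t A A B + t B A A + \<delta> * t B A B + t B A V + t B B B + t B V B + t V A B) * Z a d b c e f +
      (t A A V + t V A A) * Z a d b f c e +
      (t A V A) * Z a e b d c f +
      (t A B B + t V V B) * Z a b c d e f +
      (t B B A + t B V V) * Z a f b c d e +
      (t A B V) * Z a b c e d f +
      (t B B V + t B V A) * Z a e b c d f +
      (t A V B + t V B B) * Z a c b d e f +
      (t V B A) * Z a c b f d e +
      (t A V V) * Z a f b d c e +
      (t V V A) * Z a e b f c d +
      (t V B V) * Z a c b e d f +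
      (t V V V) * Z a f b e c d)))"
proof -
  have ne: "p \<noteq> q" "q \<noteq> p" "p \<noteq> r" "r \<noteq> p" "q \<noteq> r" "r \<noteq> q"
    using assms(1) by auto
  have ne': "x \<noteq> p" "x \<noteq> q" "x \<noteq> r" "p \<noteq> x" "q \<noteq> x" "r \<noteq> x" if "x \<in> {a, b, c, d, e, f}" for x
    using assms(2) that by auto
  have N: "p \<notin> N" "q \<notin> N" "r \<notin> N" "a \<in> N" "b \<in> N" "c \<in> N" "d \<in> N" "e \<in> N" "f \<in> N"
    using assms(3,4) by auto
  show ?thesis
    by (simp add: ne ne' N reduce assms(5,6) link_commute link_left_commute Z_def)
      (simp add: assms(7-10) t_def tri'_def algebra_simps)
qed

lemma triangle_colors:
  "(\<exists>y. b = otri y a \<and> c = otri (otri d y) (utri a y) \<and> e = utri y d \<and>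
      f = utri (utri a y) (otri d y)) \<longleftrightarrow>
   c = otri (otri d a) b \<and> utri b (otri d a) = otri e (utri a d) \<and> f = utri (utri a d) e"
proof -
  obtain y where y: "b = otri y a"
    using ex_alpha by metis
  have "utri b (otri d a) = otri (utri y d) (utri a d)"
    using exchange_uo[of y d a] y by simp
  moreover have "otri (otri d a) b = otri (otri d y) (utri a y)"
    using exchange_oo[of d a y] y by simp
  moreover have "utri (utri a d) (utri y d) = utri (utri a y) (otri d y)"
    using exchange_uu[of a d y] by simp
  ultimately show ?thesis
    using y by (auto simp: alpha_inj)
qed

lemma sim_triangle_positive:
  assumes pqr: "distinct [p, q, r]" "{p, q, r} \<inter> (list_edges R \<union> {a, b, c, d, e, f}) = {}"
  shows "sim
    ([Crossing Positive a b p q, Crossing Positive q c r f, Crossing Positive p r d e] @ R)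
    ([Crossing Positive b c p q, Crossing Positive a p d r, Crossing Positive r q e f] @ R)"
    (is "sim (?T1 @ R) (?T2 @ R)")
proof (rule local_move[where E = "{a, b, c, d, e, f}" and ?I1.0 = "{p, q, r}" and ?I2.0 = "{p, q, r}"])
  show "list_edges ?T1 = {a, b, c, d, e, f} \<union> {p, q, r}"
    "list_edges ?T2 = {a, b, c, d, e, f} \<union> {p, q, r}" by auto
  show "({p, q, r} \<union> {p, q, r}) \<inter> ({a, b, c, d, e, f} \<union> list_edges R) = {}"
    using pqr by auto
  have ne: "x \<noteq> p \<and> x \<noteq> q \<and> x \<noteq> r" if "x \<in> {a, b, c, d, e, f}" for x
    using pqr(2) that by auto
  have pqr': "p \<noteq> q" "q \<noteq> p" "p \<noteq> r" "r \<noteq> p" "q \<noteq> r" "r \<noteq> q"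
    using pqr(1) by auto
  fix \<phi>
  {
    assume "fits \<phi> ?T1"
    then have "\<phi> c = otri (otri (\<phi> d) (\<phi> a)) (\<phi> b) \<and>
        utri (\<phi> b) (otri (\<phi> d) (\<phi> a)) = otri (\<phi> e) (utri (\<phi> a) (\<phi> d)) \<and>
        \<phi> f = utri (utri (\<phi> a) (\<phi> d)) (\<phi> e)"
      unfolding triangle_colors[symmetric] by (intro exI[of _ "\<phi> p"]) auto
    then show "\<exists>\<psi>. fits \<psi> ?T2 \<and> (\<forall>x. x \<notin> {p, q, r} \<union> {p, q, r} \<longrightarrow> \<psi> x = \<phi> x)"
      by (intro exI[of _ "\<phi>(p := otri (\<phi> d) (\<phi> a), q := utri (\<phi> b) (otri (\<phi> d) (\<phi> a)),
            r := utri (\<phi> a) (\<phi> d))"]) (simp add: ne pqr')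
  next
    assume "fits \<phi> ?T2"
    then have "\<phi> c = otri (otri (\<phi> d) (\<phi> a)) (\<phi> b) \<and>
        utri (\<phi> b) (otri (\<phi> d) (\<phi> a)) = otri (\<phi> e) (utri (\<phi> a) (\<phi> d)) \<and>
        \<phi> f = utri (utri (\<phi> a) (\<phi> d)) (\<phi> e)"
      by auto
    then obtain y where "\<phi> b = otri y (\<phi> a)" "\<phi> c = otri (otri (\<phi> d) y) (utri (\<phi> a) y)"
      "\<phi> e = utri y (\<phi> d)" "\<phi> f = utri (utri (\<phi> a) y) (otri (\<phi> d) y)"
      unfolding triangle_colors[symmetric] by auto
    then show "\<exists>\<psi>. fits \<psi> ?T1 \<and> (\<forall>x. x \<notin> {p, q, r} \<union> {p, q, r} \<longrightarrow> \<psi> x = \<phi> x)"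
      by (intro exI[of _ "\<phi>(p := y, q := utri (\<phi> a) y, r := otri (\<phi> d) y)"])
        (simp add: ne pqr')
  next
    fix \<psi>
    assume fit: "fits \<phi> ?T1" "fits \<psi> ?T1" and agree: "\<forall>x\<in>{a, b, c, d, e, f}. \<phi> x = \<psi> x"
    from agree have ad: "\<phi> a = \<psi> a" "\<phi> d = \<psi> d" and "\<phi> b = \<psi> b"
      by simp_all
    moreover have "\<phi> b = otri (\<phi> p) (\<phi> a)" "\<psi> b = otri (\<psi> p) (\<psi> a)"
      using fit by simp_all
    ultimately have "otri (\<phi> p) (\<phi> a) = otri (\<psi> p) (\<phi> a)"
      by metis
    then have "\<phi> p = \<psi> p"
      by (simp add: alpha_inj)
    moreover have "\<phi> q = utri (\<phi> a) (\<phi> p)" "\<psi> q = utri (\<psi> a) (\<psi> p)"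
      "\<phi> r = otri (\<phi> d) (\<phi> p)" "\<psi> r = otri (\<psi> d) (\<psi> p)"
      using fit by simp_all
    ultimately show "\<forall>x\<in>{p, q, r}. \<phi> x = \<psi> x"
      using ad by simp
  next
    fix \<psi>
    assume fit: "fits \<phi> ?T2" "fits \<psi> ?T2" and agree: "\<forall>x\<in>{a, b, c, d, e, f}. \<phi> x = \<psi> x"
    from agree have "\<phi> a = \<psi> a" "\<phi> b = \<psi> b" "\<phi> d = \<psi> d"
      by simp_all
    moreover have "\<phi> q = utri (\<phi> b) (\<phi> p)" "\<psi> q = utri (\<psi> b) (\<psi> p)"
      "\<phi> r = utri (\<phi> a) (\<phi> d)" "\<psi> r = utri (\<psi> a) (\<psi> d)"
      "\<phi> p = otri (\<phi> d) (\<phi> a)" "\<psi> p = otri (\<psi> d) (\<psi> a)"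
      using fit by simp_all
    ultimately have "\<phi> p = \<psi> p \<and> \<phi> q = \<psi> q \<and> \<phi> r = \<psi> r"
      by metis
    then show "\<forall>x\<in>{p, q, r}. \<phi> x = \<psi> x"
      by simp
  next
    fix \<psi> N
    assume fit: "fits \<phi> ?T1" "fits \<psi> ?T2"
      and agree: "\<forall>x\<in>{a, b, c, d, e, f}. \<phi> x = \<psi> x"
      and N: "finite N" "{a, b, c, d, e, f} \<subseteq> N" "list_edges R \<subseteq> N"
        "({p, q, r} \<union> {p, q, r}) \<inter> N = {}"
      and R: "\<And>G. bracket N \<psi> R G = bracket N \<phi> R G"
    have "{p, q, r} \<inter> {a, b, c, d, e, f} = {}" "{p, q, r} \<inter> N = {}"
      using pqr(2) N(4) by auto
    note hyps = pqr(1) this N(2,1,3)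
    \<comment> \<open>The trivial first equation fixes \<open>y\<close> in
      \<open>bracket_triangle_left\<close> as \<open>\<phi> p\<close>. The facts \<open>M\<close>
      use the same value, so that both expansions speak of the same triple of colors.\<close>
    have L: "\<phi> p = \<phi> p" "\<phi> q = utri (\<phi> a) (\<phi> p)" "\<phi> r = otri (\<phi> d) (\<phi> p)"
      using fit(1) by simp_all
    have ad: "\<psi> a = \<phi> a" "\<psi> d = \<phi> d" and be: "\<psi> b = \<phi> b" "\<psi> e = \<phi> e"
      using agree by simp_all
    have "\<phi> b = otri (\<phi> p) (\<phi> a)" "\<phi> e = utri (\<phi> p) (\<phi> d)"
      using fit(1) by simp_all
    then have M: "\<psi> b = otri (\<phi> p) (\<psi> a)" "\<psi> e = utri (\<phi> p) (\<psi> d)"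
      "\<psi> p = otri (\<psi> d) (\<psi> a)" "\<psi> r = utri (\<psi> a) (\<psi> d)"
      unfolding ad be using fit(2) by (simp_all add: ad)
    show "bracket ({p, q, r} \<union> N) \<phi> (?T1 @ R) {} = bracket ({p, q, r} \<union> N) \<psi> (?T2 @ R) {}"
      unfolding bracket_triangle_left[OF hyps L] bracket_triangle_right[OF hyps M] R ad
      by (simp only: iii_1 iii_2 iii_3 iii_4 iii_5 iii_6 iii_7 iii_8 iii_9 iii_10 iii_11
          iii_12 iii_13 iii_14 iii_15)
  }
qed

section \<open>The first two moves\<close>

text \<open>The smoothing along the orientation splits off the loop, hence \<delta> beside A; the
  other two replacements leave a single strand.\<close>

lemma kink_positive_value: "w' * (A x x * (\<delta> * z) + B x x * z + V x x * z) = z"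
proof -
  have "w' * (A x x * (\<delta> * z) + B x x * z + V x x * z) = w' * (\<delta> * A x x + B x x + V x x) * z"
    by (simp add: algebra_simps)
  also have "\<dots> = z"
    using i_pos[of x] unit by (simp add: mult.commute)
  finally show ?thesis .
qed

lemma kink_negative_value: "w * (C x x * (\<delta> * z) + D x x * z + U x x * z) = z"
proof -
  have "w * (C x x * (\<delta> * z) + D x x * z + U x x * z) = w * (\<delta> * C x x + D x x + U x x) * z"
    by (simp add: algebra_simps)
  also have "\<dots> = z"
    using i_neg[of x] unit by simp
  finally show ?thesis .
qed

text \<open>The loop occupies both right-hand corners. Its color is thus $x^y = y_x$ for the color
  pair $(x, y)$, and \<open>utri_eq_otri\<close> makes the two ends agree.\<close>

lemma sim_kink_right:
  assumes p: "p \<notin> list_edges R \<union> {a, d}"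
  shows "sim ([Crossing k a p d p] @ R) ([Mark a d] @ R)" (is "sim (?T1 @ R) (?T2 @ R)")
proof (rule local_move[where E = "{a, d}" and ?I1.0 = "{p}" and ?I2.0 = "{}"])
  from p have ne: "p \<noteq> a" "a \<noteq> p" "p \<noteq> d" "d \<noteq> p" by auto
  have colors: "\<phi> a = \<phi> d" if "fits \<phi> ?T1" for \<phi>
    using that utri_eq_otri[of "\<phi> a" "\<phi> d"] utri_eq_otri[of "\<phi> d" "\<phi> a"]
    by (cases k) auto
  fix \<phi>
  show "\<exists>\<psi>. fits \<psi> ?T2 \<and> (\<forall>e. e \<notin> {p} \<union> {} \<longrightarrow> \<psi> e = \<phi> e)" if "fits \<phi> ?T1"
    using colors[OF that] by (intro exI[of _ \<phi>]) simp
  show "\<exists>\<psi>. fits \<psi> ?T1 \<and> (\<forall>e. e \<notin> {p} \<union> {} \<longrightarrow> \<psi> e = \<phi> e)" if "fits \<phi> ?T2"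
  proof -
    let ?\<psi> = "\<phi>(p := if k = Virtual then \<phi> a else utri (\<phi> a) (\<phi> a))"
    have "fits ?\<psi> ?T1"
      using that ne diagonal by (cases k) auto
    then show ?thesis by (intro exI[of _ ?\<psi>] conjI) simp_all
  qed
  fix \<psi>
  show "\<forall>e\<in>{p}. \<phi> e = \<psi> e"
    if "fits \<phi> ?T1" "fits \<psi> ?T1" and agree: "\<forall>e\<in>{a, d}. \<phi> e = \<psi> e"
  proof -
    have ad: "\<phi> a = \<psi> a" "\<phi> d = \<psi> d" using agree by auto
    show ?thesis
      using that(1,2) by (cases k) (simp_all, (metis ad)+)
  qed
  fix N
  assume fit: "fits \<phi> ?T1" and N: "finite N" "{a, d} \<subseteq> N" "list_edges R \<subseteq> N" "({p} \<union> {}) \<inter> N = {}"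
    and R: "\<And>G. bracket N \<psi> R G = bracket N \<phi> R G"
  show "bracket ({p} \<union> N) \<phi> (?T1 @ R) {} = bracket ({} \<union> N) \<psi> (?T2 @ R) {}"
    using N ne colors[OF fit]
    by (cases k) (simp_all add: reduce R link_commute link_left_commute
        kink_positive_value kink_negative_value)
qed (use p in auto)

text \<open>Here the loop occupies both left-hand corners and the color pair is $(x, x)$, so the
  ends agree by the diagonal axiom. The color of the loop has to be found from that of the ends: it
  exists by \<open>ex_diagonal\<close> and is unique because $S$ is injective.\<close>

lemma sim_kink_left:
  assumes p: "p \<notin> list_edges R \<union> {a, d}"
  shows "sim ([Crossing k p d p a] @ R) ([Mark d a] @ R)" (is "sim (?T1 @ R) (?T2 @ R)")
proof (rule local_move[where E = "{a, d}" and ?I1.0 = "{p}" and ?I2.0 = "{}"])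
  from p have ne: "p \<noteq> a" "a \<noteq> p" "p \<noteq> d" "d \<noteq> p" by auto
  have colors: "\<phi> a = \<phi> d" if "fits \<phi> ?T1" for \<phi>
    using that diagonal by (cases k) auto
  fix \<phi>
  show "\<exists>\<psi>. fits \<psi> ?T2 \<and> (\<forall>e. e \<notin> {p} \<union> {} \<longrightarrow> \<psi> e = \<phi> e)" if "fits \<phi> ?T1"
    using colors[OF that] by (intro exI[of _ \<phi>]) simp
  show "\<exists>\<psi>. fits \<psi> ?T1 \<and> (\<forall>e. e \<notin> {p} \<union> {} \<longrightarrow> \<psi> e = \<phi> e)" if "fits \<phi> ?T2"
  proof -
    obtain x where x: "\<phi> a = otri x x"
      using ex_diagonal by blast
    let ?\<psi> = "\<phi>(p := if k = Virtual then \<phi> a else x)"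
    have "fits ?\<psi> ?T1"
      using that ne diagonal x by (cases k) auto
    then show ?thesis by (intro exI[of _ ?\<psi>] conjI) simp_all
  qed
  fix \<psi>
  show "\<forall>e\<in>{p}. \<phi> e = \<psi> e"
    if "fits \<phi> ?T1" "fits \<psi> ?T1" and agree: "\<forall>e\<in>{a, d}. \<phi> e = \<psi> e"
  proof -
    have ad: "\<phi> a = \<psi> a" "\<phi> d = \<psi> d" using agree by auto
    show ?thesis
      using that(1,2) by (cases k) (simp_all, (metis S_inj ad)+)
  qed
  fix N
  assume fit: "fits \<phi> ?T1" and N: "finite N" "{a, d} \<subseteq> N" "list_edges R \<subseteq> N" "({p} \<union> {}) \<inter> N = {}"
    and R: "\<And>G. bracket N \<psi> R G = bracket N \<phi> R G"
  show "bracket ({p} \<union> N) \<phi> (?T1 @ R) {} = bracket ({} \<union> N) \<psi> (?T2 @ R) {}"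
    using N ne colors[OF fit]
    by (cases k) (simp_all add: reduce R link_commute link_left_commute
        kink_positive_value kink_negative_value)
qed (use p in auto)

text \<open>The nine states of a bigon, sorted by pairings: \<open>z1\<close> stands for the two
  strands, \<open>z2\<close> for joining the upper ends to each other and the lower ends to each
  other, \<open>z3\<close> for crossed strands. With B and D the inner edges close to a
  curve.\<close>

lemma bigon_parallel_value:
  "(A x y * C x y + V x y * U x y) * z1 +
   (\<delta> * B x y * D x y + A x y * D x y + B x y * C x y + (B x y * U x y + V x y * D x y)) * z2 +
   (A x y * U x y + V x y * C x y) * z3 = z1"
  by (simp flip: ii_1 ii_3 ii_4 ii_5)

text \<open>For antiparallel strands the smoothings against the orientation keep the strands apart
  and those along it close the inner curve.\<close>

lemma bigon_antiparallel_value: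
  "(B x y * D x y + V x y * U x y) * z1 +
   (\<delta> * A x y * C x y + A x y * D x y + B x y * C x y + (A x y * U x y + V x y * C x y)) * z2 +
   (B x y * U x y + V x y * D x y) * z3 = z1"
  by (simp flip: ii_2 ii_3 ii_4 ii_6)

lemma unit_value: "w' * (w * z) = z" "w * (w' * z) = z"
  using unit by (simp_all flip: mult.assoc add: mult.commute[of w' w])

lemma sim_bigon_parallel:
  assumes pq: "p \<noteq> q" "{p, q} \<inter> (list_edges R \<union> {a, b, d, e}) = {}"
  shows "sim ([Crossing (parallel_kind l) a b p q, Crossing (parallel_kind (flip l)) p q d e] @ R)
    ([Mark a d, Mark b e] @ R)" (is "sim (?T1 @ R) (?T2 @ R)")
proof (rule local_move[where E = "{a, b, d, e}" and ?I1.0 = "{p, q}" and ?I2.0 = "{}"])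
  from pq have ne: "p \<noteq> q" "q \<noteq> p" "p \<noteq> a" "a \<noteq> p" "p \<noteq> b" "b \<noteq> p" "p \<noteq> d" "d \<noteq> p" "p \<noteq> e" "e \<noteq> p"
    "q \<noteq> a" "a \<noteq> q" "q \<noteq> b" "b \<noteq> q" "q \<noteq> d" "d \<noteq> q" "q \<noteq> e" "e \<noteq> q" by auto
  have colors: "\<phi> a = \<phi> d \<and> \<phi> b = \<phi> e" if "fits \<phi> ?T1" for \<phi>
    using that by (cases l) (simp_all, (metis alpha_inj beta_inj)+)
  fix \<phi>
  show "\<exists>\<psi>. fits \<psi> ?T2 \<and> (\<forall>x. x \<notin> {p, q} \<union> {} \<longrightarrow> \<psi> x = \<phi> x)" if "fits \<phi> ?T1"
    using colors[OF that] by (intro exI[of _ \<phi>]) simp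
  show "\<exists>\<psi>. fits \<psi> ?T1 \<and> (\<forall>x. x \<notin> {p, q} \<union> {} \<longrightarrow> \<psi> x = \<phi> x)" if "fits \<phi> ?T2"
  proof (cases l)
    case Over
    obtain y where "\<phi> b = utri y (\<phi> a)" using ex_beta by blast
    with Over that ne show ?thesis
      by (intro exI[of _ "\<phi>(p := y, q := otri (\<phi> a) y)"]) auto
  next
    case Under
    obtain y where "\<phi> b = otri y (\<phi> a)" using ex_alpha by blast
    with Under that ne show ?thesis
      by (intro exI[of _ "\<phi>(p := y, q := utri (\<phi> a) y)"]) auto
  next
    case Flat
    with that ne show ?thesis
      by (intro exI[of _ "\<phi>(p := \<phi> b, q := \<phi> a)"]) auto
  qed
  fix \<psi>
  show "\<forall>x\<in>{p, q}. \<phi> x = \<psi> x"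
    if "fits \<phi> ?T1" "fits \<psi> ?T1" and agree: "\<forall>x\<in>{a, b, d, e}. \<phi> x = \<psi> x"
  proof -
    have ab: "\<phi> a = \<psi> a" "\<phi> b = \<psi> b" using agree by auto
    show ?thesis
      using that(1,2) by (cases l) (simp_all, (metis alpha_inj beta_inj ab)+)
  qed
  fix N
  assume fit: "fits \<phi> ?T1" and N: "finite N" "{a, b, d, e} \<subseteq> N" "list_edges R \<subseteq> N"
    "({p, q} \<union> {}) \<inter> N = {}" and R: "\<And>G. bracket N \<psi> R G = bracket N \<phi> R G"
  from N have N': "p \<notin> N" "q \<notin> N" "a \<in> N" "b \<in> N" "d \<in> N" "e \<in> N" by auto
  let ?z = "\<lambda>x1 x2 y1 y2. bracket N \<phi> R (link x1 x2 (link y1 y2 {}))"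
  show "bracket ({p, q} \<union> N) \<phi> (?T1 @ R) {} = bracket ({} \<union> N) \<psi> (?T2 @ R) {}"
  proof (cases l)
    case Over
    \<comment> \<open>Read backwards, \<open>bigon_parallel_value\<close> expands the two strands
      into the nine states of the bigon. Both crossings have the same color pair, as (ii)
      demands.\<close>
    have "bracket ({p, q} \<union> N) \<phi> (?T1 @ R) {} = w' * (w * ?z a d b e)"
      by (subst (2) bigon_parallel_value[of "\<phi> p" "\<phi> a" _ "?z a b d e" "?z a e b d", symmetric])
       (use Over colors[OF fit] in \<open>simp add: ne N' N(1,3) reduce link_commute link_left_commute algebra_simps\<close>)
    then show ?thesis by (simp add: unit_value R link_commute link_left_commute)
  next
    case Under
    have "bracket ({p, q} \<union> N) \<phi> (?T1 @ R) {} = w' * (w * ?z a d b e)"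
      by (subst (2) bigon_parallel_value[of "\<phi> a" "\<phi> p" _ "?z a b d e" "?z a e b d", symmetric])
       (use Under colors[OF fit] in \<open>simp add: ne N' N(1,3) reduce link_commute link_left_commute algebra_simps\<close>)
    then show ?thesis by (simp add: unit_value R link_commute link_left_commute)
  next
    case Flat
    then show ?thesis
      by (simp add: ne N' N(1,3) reduce R link_commute link_left_commute)
  qed
qed (use pq in auto)

text \<open>The inner edges are the left-hand corners of both crossings, so the inner colors form
  the color pair and are obtained from the ends by inverting $S$.\<close>

lemma sim_bigon_left:
  assumes pq: "p \<noteq> q" "{p, q} \<inter> (list_edges R \<union> {a, b, d, e}) = {}"
  shows "sim ([Crossing (parallel_kind l) p a q b, Crossing (parallel_kind (flip l)) q e p d] @ R)
    ([Mark a d, Mark e b] @ R)" (is "sim (?T1 @ R) (?T2 @ R)")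
proof (rule local_move[where E = "{a, b, d, e}" and ?I1.0 = "{p, q}" and ?I2.0 = "{}"])
  from pq have ne: "p \<noteq> q" "q \<noteq> p" "p \<noteq> a" "a \<noteq> p" "p \<noteq> b" "b \<noteq> p" "p \<noteq> d" "d \<noteq> p" "p \<noteq> e" "e \<noteq> p"
    "q \<noteq> a" "a \<noteq> q" "q \<noteq> b" "b \<noteq> q" "q \<noteq> d" "d \<noteq> q" "q \<noteq> e" "e \<noteq> q" by auto
  have colors: "\<phi> a = \<phi> d \<and> \<phi> b = \<phi> e" if "fits \<phi> ?T1" for \<phi>
    using that by (cases l) simp_all
  fix \<phi>
  show "\<exists>\<psi>. fits \<psi> ?T2 \<and> (\<forall>x. x \<notin> {p, q} \<union> {} \<longrightarrow> \<psi> x = \<phi> x)" if "fits \<phi> ?T1"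
    using colors[OF that] by (intro exI[of _ \<phi>]) simp
  show "\<exists>\<psi>. fits \<psi> ?T1 \<and> (\<forall>x. x \<notin> {p, q} \<union> {} \<longrightarrow> \<psi> x = \<phi> x)" if "fits \<phi> ?T2"
  proof (cases l)
    case Over
    obtain x y where "\<phi> b = otri x y" "\<phi> a = utri y x" using ex_S by blast
    with Over that ne show ?thesis
      by (intro exI[of _ "\<phi>(p := x, q := y)"]) auto
  next
    case Under
    obtain x y where "\<phi> a = otri y x" "\<phi> b = utri x y" using ex_S by blast
    with Under that ne show ?thesis
      by (intro exI[of _ "\<phi>(p := x, q := y)"]) auto
  next
    case Flat
    with that ne show ?thesis
      by (intro exI[of _ "\<phi>(p := \<phi> b, q := \<phi> a)"]) auto
  qed
  fix \<psi>
  show "\<forall>x\<in>{p, q}. \<phi> x = \<psi> x"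
    if "fits \<phi> ?T1" "fits \<psi> ?T1" and agree: "\<forall>x\<in>{a, b, d, e}. \<phi> x = \<psi> x"
  proof -
    have ab: "\<phi> a = \<psi> a" "\<phi> b = \<psi> b" using agree by auto
    show ?thesis
      using that(1,2) by (cases l) (simp_all, (metis S_inj ab)+)
  qed
  fix N
  assume fit: "fits \<phi> ?T1" and N: "finite N" "{a, b, d, e} \<subseteq> N" "list_edges R \<subseteq> N"
    "({p, q} \<union> {}) \<inter> N = {}" and R: "\<And>G. bracket N \<psi> R G = bracket N \<phi> R G"
  from N have N': "p \<notin> N" "q \<notin> N" "a \<in> N" "b \<in> N" "d \<in> N" "e \<in> N" by auto
  let ?z = "\<lambda>x1 x2 y1 y2. bracket N \<phi> R (link x1 x2 (link y1 y2 {}))"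
  show "bracket ({p, q} \<union> N) \<phi> (?T1 @ R) {} = bracket ({} \<union> N) \<psi> (?T2 @ R) {}"
  proof (cases l)
    case Over
    have "bracket ({p, q} \<union> N) \<phi> (?T1 @ R) {} = w' * (w * ?z a d b e)"
      by (subst (2) bigon_antiparallel_value[of "\<phi> q" "\<phi> p" _ "?z a b d e" "?z a e b d", symmetric])
       (use Over colors[OF fit] in \<open>simp add: ne N' N(1,3) reduce link_commute link_left_commute algebra_simps\<close>)
    then show ?thesis by (simp add: unit_value R link_commute link_left_commute)
  next
    case Under
    have "bracket ({p, q} \<union> N) \<phi> (?T1 @ R) {} = w' * (w * ?z a d b e)"
      by (subst (2) bigon_antiparallel_value[of "\<phi> p" "\<phi> q" _ "?z a b d e" "?z a e b d", symmetric])
       (use Under colors[OF fit] in \<open>simp add: ne N' N(1,3) reduce link_commute link_left_commute algebra_simps\<close>)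
    then show ?thesis by (simp add: unit_value R link_commute link_left_commute)
  next
    case Flat
    then show ?thesis
      by (simp add: ne N' N(1,3) reduce R link_commute link_left_commute)
  qed
qed (use pq in auto)

text \<open>The inner edges are the right-hand corners, so their colors are computed from the ends.
  Injectivity of $S$ shows that the colors of the upper and the lower ends coincide.\<close>

lemma sim_bigon_right:
  assumes pq: "p \<noteq> q" "{p, q} \<inter> (list_edges R \<union> {a, b, d, e}) = {}"
  shows "sim ([Crossing (parallel_kind l) b q a p, Crossing (parallel_kind (flip l)) d p e q] @ R)
    ([Mark b e, Mark d a] @ R)" (is "sim (?T1 @ R) (?T2 @ R)")
proof (rule local_move[where E = "{a, b, d, e}" and ?I1.0 = "{p, q}" and ?I2.0 = "{}"])
  from pq have ne: "p \<noteq> q" "q \<noteq> p" "p \<noteq> a" "a \<noteq> p" "p \<noteq> b" "b \<noteq> p" "p \<noteq> d" "d \<noteq> p" "p \<noteq> e" "e \<noteq> p"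
    "q \<noteq> a" "a \<noteq> q" "q \<noteq> b" "b \<noteq> q" "q \<noteq> d" "d \<noteq> q" "q \<noteq> e" "e \<noteq> q" by auto
  have colors: "\<phi> a = \<phi> d \<and> \<phi> b = \<phi> e" if "fits \<phi> ?T1" for \<phi>
    using that by (cases l) (simp_all, (metis S_inj)+)
  fix \<phi>
  show "\<exists>\<psi>. fits \<psi> ?T2 \<and> (\<forall>x. x \<notin> {p, q} \<union> {} \<longrightarrow> \<psi> x = \<phi> x)" if "fits \<phi> ?T1"
    using colors[OF that] by (intro exI[of _ \<phi>]) simp
  show "\<exists>\<psi>. fits \<psi> ?T1 \<and> (\<forall>x. x \<notin> {p, q} \<union> {} \<longrightarrow> \<psi> x = \<phi> x)" if "fits \<phi> ?T2"
  proof (cases l)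
    case Over
    with that ne show ?thesis
      by (intro exI[of _ "\<phi>(p := otri (\<phi> b) (\<phi> a), q := utri (\<phi> a) (\<phi> b))"]) auto
  next
    case Under
    with that ne show ?thesis
      by (intro exI[of _ "\<phi>(p := utri (\<phi> b) (\<phi> a), q := otri (\<phi> a) (\<phi> b))"]) auto
  next
    case Flat
    with that ne show ?thesis
      by (intro exI[of _ "\<phi>(p := \<phi> b, q := \<phi> a)"]) auto
  qed
  fix \<psi>
  show "\<forall>x\<in>{p, q}. \<phi> x = \<psi> x"
    if "fits \<phi> ?T1" "fits \<psi> ?T1" and agree: "\<forall>x\<in>{a, b, d, e}. \<phi> x = \<psi> x"
  proof -
    have ab: "\<phi> a = \<psi> a" "\<phi> b = \<psi> b" using agree by auto
    show ?thesis
      using that(1,2) by (cases l) (simp_all, (metis ab)+)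
  qed
  fix N
  assume fit: "fits \<phi> ?T1" and N: "finite N" "{a, b, d, e} \<subseteq> N" "list_edges R \<subseteq> N"
    "({p, q} \<union> {}) \<inter> N = {}" and R: "\<And>G. bracket N \<psi> R G = bracket N \<phi> R G"
  from N have N': "p \<notin> N" "q \<notin> N" "a \<in> N" "b \<in> N" "d \<in> N" "e \<in> N" by auto
  let ?z = "\<lambda>x1 x2 y1 y2. bracket N \<phi> R (link x1 x2 (link y1 y2 {}))"
  show "bracket ({p, q} \<union> N) \<phi> (?T1 @ R) {} = bracket ({} \<union> N) \<psi> (?T2 @ R) {}"
  proof (cases l)
    case Over
    have "bracket ({p, q} \<union> N) \<phi> (?T1 @ R) {} = w' * (w * ?z a d b e)"
      by (subst (2) bigon_antiparallel_value[of "\<phi> a" "\<phi> b" _ "?z a b d e" "?z a e b d", symmetric])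
       (use Over colors[OF fit] in \<open>simp add: ne N' N(1,3) reduce link_commute link_left_commute algebra_simps\<close>)
    then show ?thesis by (simp add: unit_value R link_commute link_left_commute)
  next
    case Under
    have "bracket ({p, q} \<union> N) \<phi> (?T1 @ R) {} = w' * (w * ?z a d b e)"
      by (subst (2) bigon_antiparallel_value[of "\<phi> b" "\<phi> a" _ "?z a b d e" "?z a e b d", symmetric])
       (use Under colors[OF fit] in \<open>simp add: ne N' N(1,3) reduce link_commute link_left_commute algebra_simps\<close>)
    then show ?thesis by (simp add: unit_value R link_commute link_left_commute)
  next
    case Flat
    then show ?thesis
      by (simp add: ne N' N(1,3) reduce R link_commute link_left_commute)
  qed
qed (use pq in auto)

end

section \<open>The third move in general\<close>

lemma flip_flip [simp]: "flip (flip l) = l"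
  by (cases l) auto

text \<open>A counterclockwise quarter turn. The former NE-SW strand now runs NW-SE with its
  direction kept; the other one is turned upside down, and the layer is read off the new NW-SE
  strand.\<close>

lemma tile_rotate: "tile (flip l) d2 (\<not> d1) b d a c = tile l d1 d2 a b c d"
  by (cases l; cases d1; cases d2) auto

lemma map_vertex_tile: "map_vertex g (tile l d1 d2 a b c d) = tile l d1 d2 (g a) (g b) (g c) (g d)"
  by (cases d1; cases d2) auto

lemma map_vertex_strand: "map_vertex g (strand d a b) = strand d (g a) (g b)"
  by (simp add: strand_def)

lemma set_vertex_tile [simp]: "set_vertex (tile l d1 d2 a b c d) = {a, b, c, d}"
  by (cases d1; cases d2) auto

lemma set_vertex_strand [simp]: "set_vertex (strand d a b) = {a, b}"
  by (auto simp: strand_def)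

lemma strand_reverse: "strand (\<not> d) b a = strand d a b"
  by (simp add: strand_def)

lemma map_vertex_fresh:
  assumes "e \<notin> list_edges vs"
  shows "map (map_vertex (id(e := x))) vs = vs"
proof (rule map_idI)
  fix v
  assume "v \<in> set vs"
  with assms have "e \<notin> set_vertex v" by (auto simp: edges_def)
  then have "map_vertex (id(e := x)) v = map_vertex (\<lambda>z. z) v"
    by (intro vertex.map_cong) auto
  then show "map_vertex (id(e := x)) v = v"
    by (simp add: vertex.map_ident)
qed

definition triangle_left ::
  "layer \<Rightarrow> layer \<Rightarrow> layer \<Rightarrow> bool \<Rightarrow> bool \<Rightarrow> bool \<Rightarrow>
   nat \<Rightarrow> nat \<Rightarrow> nat \<Rightarrow> nat \<Rightarrow> nat \<Rightarrow> nat \<Rightarrow> nat \<Rightarrow> nat \<Rightarrow> nat \<Rightarrow> nat vertex list" where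
  "triangle_left l12 l13 l23 d1 d2 d3 a b c d e f p q r =
     [tile l12 d1 d2 a b p q, tile l13 d1 d3 q c r f, tile l23 d2 d3 p r d e]"

definition triangle_right ::
  "layer \<Rightarrow> layer \<Rightarrow> layer \<Rightarrow> bool \<Rightarrow> bool \<Rightarrow> bool \<Rightarrow>
   nat \<Rightarrow> nat \<Rightarrow> nat \<Rightarrow> nat \<Rightarrow> nat \<Rightarrow> nat \<Rightarrow> nat \<Rightarrow> nat \<Rightarrow> nat \<Rightarrow> nat vertex list" where
  "triangle_right l12 l13 l23 d1 d2 d3 a b c d e f p q r =
     [tile l23 d2 d3 b c p q, tile l13 d1 d3 a p d r, tile l12 d1 d2 r q e f]"

text \<open>Around the disk the ends are \<open>a\<close>, \<open>b\<close>, \<open>c\<close>,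
  \<open>f\<close>, \<open>e\<close>, \<open>d\<close>. A sixth of a turn shifts them by one place
  and exchanges the two sides of the move.\<close>

lemma triangle_rotate:
  "triangle_left l23 (flip l12) (flip l13) d2 d3 (\<not> d1) b c f a d e p q r =
   [tile l23 d2 d3 b c p q, tile l12 d1 d2 r q e f, tile l13 d1 d3 a p d r]"
  "triangle_right l23 (flip l12) (flip l13) d2 d3 (\<not> d1) b c f a d e q r p =
   [tile l13 d1 d3 q c r f, tile l12 d1 d2 a b p q, tile l23 d2 d3 p r d e]"
  by (simp_all add: triangle_left_def triangle_right_def tile_rotate)

context biquandle_virtual_bracket
begin

text \<open>Neither colors nor connections depend on the direction of a mark, so a
  \<open>strand\<close> can be contracted from either end.\<close>

lemma sim_Mark_commute: "sim (Mark a b # vs) (Mark b a # vs)"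
proof -
  have "colorings utri otri (set (Mark a b # vs)) = colorings utri otri (set (Mark b a # vs))"
    by (auto simp: colorings_def insert_commute)
  then show ?thesis
    by (simp add: sim_def link_commute[of a b] insert_commute[of a b] same_multiset_refl)
qed

lemma sim_strand:
  assumes "a \<noteq> b" "b \<in> list_edges vs"
  shows "sim (strand d a b # vs) (map (map_vertex (id(b := a))) vs)"
proof -
  have "sim (strand d a b # vs) (Mark a b # vs)"
    by (cases d) (auto simp: strand_def intro: sim_Mark_commute sim_mset)
  then show ?thesis
    using sim_unmark[OF assms] by (rule sim_trans)
qed

text \<open>Two upward strands form the parallel bigon turned upside down; the antiparallel cases
  are \<open>sim_bigon_left\<close> and \<open>sim_bigon_right\<close>.\<close>

lemma sim_bigon:
  assumes pq: "p \<noteq> q" "{p, q} \<inter> (list_edges R \<union> {a, b, d, e}) = {}"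
  shows "sim ([tile l d1 d2 a b p q, tile (flip l) d2 d1 p q d e] @ R)
    ([strand d1 a d, strand d2 b e] @ R)"
proof (cases d1; cases d2)
  assume "d1" "d2"
  then show ?thesis
    using sim_bigon_parallel[OF pq] by (simp add: strand_def)
next
  assume d: "\<not> d1" "\<not> d2"
  have "sim ([tile l d1 d2 a b p q, tile (flip l) d2 d1 p q d e] @ R)
      ([Crossing (parallel_kind (flip l)) e d q p, Crossing (parallel_kind (flip (flip l))) q p b a] @ R)"
    using d by (intro sim_mset) simp
  also have "sim \<dots> ([Mark e b, Mark d a] @ R)"
    using pq by (intro sim_bigon_parallel) auto
  also have "sim \<dots> ([strand d1 a d, strand d2 b e] @ R)"
    using d by (intro sim_mset) (simp add: strand_def)
  finally show ?thesis .
next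
  assume d: "d1" "\<not> d2"
  then show ?thesis
    using sim_bigon_left[OF pq, of "flip l"] by (simp add: strand_def)
next
  assume d: "\<not> d1" "d2"
  have "sim ([tile l d1 d2 a b p q, tile (flip l) d2 d1 p q d e] @ R) ([Mark b e, Mark d a] @ R)"
    using d sim_bigon_right[OF pq, of "flip l"] by simp
  also have "sim \<dots> ([strand d1 a d, strand d2 b e] @ R)"
    using d by (intro sim_mset) (simp add: strand_def)
  finally show ?thesis .
qed

text \<open>The ends may coincide, and the rest is arbitrary. This lets the move be applied inside a
  larger picture, as the exchange of strands requires.\<close>

definition triangle_move :: "layer \<Rightarrow> layer \<Rightarrow> layer \<Rightarrow> bool \<Rightarrow> bool \<Rightarrow> bool \<Rightarrow> bool" where
  "triangle_move l12 l13 l23 d1 d2 d3 \<longleftrightarrow>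
     (\<forall>R a b c d e f p q r. distinct [p, q, r] \<longrightarrow>
        {p, q, r} \<inter> (list_edges R \<union> {a, b, c, d, e, f}) = {} \<longrightarrow>
        sim (triangle_left l12 l13 l23 d1 d2 d3 a b c d e f p q r @ R)
          (triangle_right l12 l13 l23 d1 d2 d3 a b c d e f p q r @ R))"

lemma triangle_moveD:
  assumes "triangle_move l12 l13 l23 d1 d2 d3"
    and "distinct [p, q, r]" "{p, q, r} \<inter> (list_edges R \<union> {a, b, c, d, e, f}) = {}"
  shows "sim (triangle_left l12 l13 l23 d1 d2 d3 a b c d e f p q r @ R)
    (triangle_right l12 l13 l23 d1 d2 d3 a b c d e f p q r @ R)"
  using assms unfolding triangle_move_def by blast

lemma sim_triangle_left_rename:
  assumes "distinct [p, q, r]" "{p, q, r} \<inter> (list_edges R \<union> {a, b, c, d, e, f}) = {}"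
    and "distinct [p', q', r']" "{p', q', r'} \<inter> (list_edges R \<union> {a, b, c, d, e, f}) = {}"
  shows "sim (triangle_left l12 l13 l23 d1 d2 d3 a b c d e f p q r @ R)
    (triangle_left l12 l13 l23 d1 d2 d3 a b c d e f p' q' r' @ R)" (is "sim (?l @ R) (?l' @ R)")
proof -
  let ?g = "id(p := p', q := q', r := r')"
  have "map (map_vertex ?g) R = R"
  proof (rule map_idI)
    fix v
    assume "v \<in> set R"
    with assms(2) have "map_vertex ?g v = map_vertex (\<lambda>x. x) v"
      by (intro vertex.map_cong) (auto simp: edges_def)
    then show "map_vertex ?g v = v"
      by (simp add: vertex.map_ident)
  qed
  moreover have "map (map_vertex ?g) ?l = ?l'"
    using assms(1,2) by (simp add: triangle_left_def map_vertex_tile)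
  moreover have "inj_on ?g (list_edges (?l @ R))"
    using assms by (intro inj_onI) (auto simp: triangle_left_def split: if_splits)
  ultimately show ?thesis
    using sim_rename[of ?g "?l @ R"] by simp
qed

lemma triangle_move_positive: "triangle_move Under Under Under True True True"
  using sim_triangle_positive by (simp add: triangle_move_def triangle_left_def triangle_right_def)

text \<open>Strand 1 is virtual throughout. Both sides contract to the crossing with corners
  \<open>b\<close>, \<open>c\<close>, \<open>d\<close>, \<open>e\<close>, of the same color pair,
  together with a link from \<open>a\<close> to \<open>f\<close>. Allowing \<open>l = Flat\<close>
  covers the move vIII too.\<close>

lemma triangle_move_flat: "triangle_move Flat Flat l True True True"
  unfolding triangle_move_def
proof (intro allI impI)
  fix R a b c d e f p q r
  assume pqr: "distinct [p, q, r]" "{p, q, r} \<inter> (list_edges R \<union> {a, b, c, d, e, f}) = {}"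
  let ?T1 = "triangle_left Flat Flat l True True True a b c d e f p q r"
  let ?T2 = "triangle_right Flat Flat l True True True a b c d e f p q r"
  have ne: "p \<noteq> q" "q \<noteq> p" "p \<noteq> r" "r \<noteq> p" "q \<noteq> r" "r \<noteq> q"
    using pqr(1) by auto
  have ne': "x \<noteq> p" "x \<noteq> q" "x \<noteq> r" "p \<noteq> x" "q \<noteq> x" "r \<noteq> x" if "x \<in> {a, b, c, d, e, f}" for x
    using pqr(2) that by auto
  have fits1: "fits \<phi> ?T1 \<longleftrightarrow> \<phi> a = \<phi> f \<and> colored utri otri \<phi> (Crossing (parallel_kind l) b c d e) \<and>
      \<phi> p = \<phi> b \<and> \<phi> q = \<phi> a \<and> \<phi> r = \<phi> c" for \<phi>
    by (cases l) (auto simp: triangle_left_def)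
  have fits2: "fits \<phi> ?T2 \<longleftrightarrow> \<phi> a = \<phi> f \<and> colored utri otri \<phi> (Crossing (parallel_kind l) b c d e) \<and>
      \<phi> p = \<phi> d \<and> \<phi> q = \<phi> e \<and> \<phi> r = \<phi> a" for \<phi>
    by (cases l) (auto simp: triangle_right_def)
  have upd: "colored utri otri (\<phi>(p := x, q := y, r := z)) (Crossing (parallel_kind l) b c d e) =
      colored utri otri \<phi> (Crossing (parallel_kind l) b c d e)" for \<phi> x y z
    by (rule colored_cong) (auto simp: ne')
  show "sim (?T1 @ R) (?T2 @ R)"
  proof (rule local_move[where E = "{a, b, c, d, e, f}" and ?I1.0 = "{p, q, r}" and ?I2.0 = "{p, q, r}"])
    show "list_edges ?T1 = {a, b, c, d, e, f} \<union> {p, q, r}"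
      "list_edges ?T2 = {a, b, c, d, e, f} \<union> {p, q, r}"
      by (auto simp: triangle_left_def triangle_right_def)
    show "({p, q, r} \<union> {p, q, r}) \<inter> ({a, b, c, d, e, f} \<union> list_edges R) = {}"
      using pqr by auto
    fix \<phi>
    show "\<exists>\<psi>. fits \<psi> ?T2 \<and> (\<forall>x. x \<notin> {p, q, r} \<union> {p, q, r} \<longrightarrow> \<psi> x = \<phi> x)" if "fits \<phi> ?T1"
      using that unfolding fits1 fits2
      by (intro exI[of _ "\<phi>(p := \<phi> d, q := \<phi> e, r := \<phi> a)"]) (simp only: upd, simp add: ne ne')
    show "\<exists>\<psi>. fits \<psi> ?T1 \<and> (\<forall>x. x \<notin> {p, q, r} \<union> {p, q, r} \<longrightarrow> \<psi> x = \<phi> x)" if "fits \<phi> ?T2"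
      using that unfolding fits1 fits2
      by (intro exI[of _ "\<phi>(p := \<phi> b, q := \<phi> a, r := \<phi> c)"]) (simp only: upd, simp add: ne ne')
    fix \<psi>
    show "\<forall>x\<in>{p, q, r}. \<phi> x = \<psi> x"
      if "fits \<phi> ?T1" "fits \<psi> ?T1" "\<forall>x\<in>{a, b, c, d, e, f}. \<phi> x = \<psi> x"
      using that unfolding fits1 by simp
    show "\<forall>x\<in>{p, q, r}. \<phi> x = \<psi> x"
      if "fits \<phi> ?T2" "fits \<psi> ?T2" "\<forall>x\<in>{a, b, c, d, e, f}. \<phi> x = \<psi> x"
      using that unfolding fits2 by simp
    fix N
    assume fit: "fits \<phi> ?T1" "fits \<psi> ?T2"
      and agree: "\<forall>x\<in>{a, b, c, d, e, f}. \<phi> x = \<psi> x"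
      and N: "finite N" "{a, b, c, d, e, f} \<subseteq> N" "list_edges R \<subseteq> N"
        "({p, q, r} \<union> {p, q, r}) \<inter> N = {}"
      and R: "\<And>G. bracket N \<psi> R G = bracket N \<phi> R G"
    have N': "p \<notin> N" "q \<notin> N" "r \<notin> N" "a \<in> N" "b \<in> N" "c \<in> N" "d \<in> N" "e \<in> N" "f \<in> N"
      using N(2,4) by auto
    have "\<phi> p = \<phi> b" "\<phi> d = \<psi> d" "\<phi> b = \<psi> b" "\<psi> p = \<psi> d"
      using fit agree unfolding fits1 fits2 by simp_all
    then show "bracket ({p, q, r} \<union> N) \<phi> (?T1 @ R) {} = bracket ({p, q, r} \<union> N) \<psi> (?T2 @ R) {}"
      by (cases l) (simp_all add: triangle_left_def triangle_right_def ne ne' N' N(1,3) reduce R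
          link_commute link_left_commute)
  qed
qed

text \<open>Turning the picture by a sixth of a full turn.\<close>

lemma triangle_move_rotate:
  assumes "triangle_move l12 l13 l23 d1 d2 d3"
  shows "triangle_move l23 (flip l12) (flip l13) d2 d3 (\<not> d1)"
  unfolding triangle_move_def
proof (intro allI impI)
  fix R b c f a d e p q r
  assume "distinct [p, q, r]" "{p, q, r} \<inter> (list_edges R \<union> {b, c, f, a, d, e}) = {}"
  then have pqr: "distinct [r, p, q]" "{r, p, q} \<inter> (list_edges R \<union> {a, b, c, d, e, f}) = {}"
    "distinct [p, q, r]" "{p, q, r} \<inter> (list_edges R \<union> {a, b, c, d, e, f}) = {}" by auto
  let ?l = "triangle_left l12 l13 l23 d1 d2 d3 a b c d e f"
  let ?r = "triangle_right l12 l13 l23 d1 d2 d3 a b c d e f"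
  show "sim (triangle_left l23 (flip l12) (flip l13) d2 d3 (\<not> d1) b c f a d e p q r @ R)
    (triangle_right l23 (flip l12) (flip l13) d2 d3 (\<not> d1) b c f a d e p q r @ R)"
    (is "sim (?l' @ R) (?r' @ R)")
  proof -
    have "sim (?l' @ R) (?r p q r @ R)"
      by (rule sim_mset) (simp add: triangle_rotate triangle_right_def)
    also have "sim \<dots> (?l p q r @ R)"
      by (rule sim_sym[OF triangle_moveD[OF assms pqr(3,4)]])
    \<comment> \<open>The turned right side with inner edges \<open>p\<close>, \<open>q\<close>,
      \<open>r\<close> is the original left side with \<open>r\<close>, \<open>p\<close>,
      \<open>q\<close>.\<close>
    also have "sim \<dots> (?l r p q @ R)"
      by (rule sim_triangle_left_rename[OF pqr(3,4,1,2)])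
    also have "sim \<dots> (?r' @ R)"
      by (rule sim_mset) (simp add: triangle_rotate triangle_left_def)
    finally show ?thesis .
  qed
qed

end

section \<open>Fresh edges, and the vertex at which an edge ends\<close>

lemma obtain_fresh4:
  assumes "finite (X :: nat set)"
  obtains s t u v where "distinct [s, t, u, v]" "{s, t, u, v} \<inter> X = {}"
proof -
  obtain m where m: "\<forall>x\<in>X. x < m"
    using assms finite_nat_set_iff_bounded by blast
  have "{m, m + 1, m + 2, m + 3} \<inter> X = {}"
    using m by force
  then show thesis
    by (intro that[of m "m + 1" "m + 2" "m + 3"]) auto
qed

text \<open>For excluding that a vertex created by a move is already in the rest of the diagram: an
  edge ending at both would be counted twice.\<close>

lemma well_formed_ins_unique:
  assumes K: "well_formed K" and "u \<in> K" "v \<in> K" "e \<in> set (ins u)" "e \<in> set (ins v)"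
  shows "u = v"
proof (rule ccontr)
  assume "u \<noteq> v"
  have pos: "count_list (ins x) e > 0" if "e \<in> set (ins x)" for x
    using that count_list_0_iff[of "ins x" e] by auto
  have "e \<in> set_vertex u"
    using assms(4) by (cases u) auto
  then have "(\<Sum>v\<in>K. count_list (ins v) e) = 1" and fin: "finite K"
    using K \<open>u \<in> K\<close> by (auto simp: well_formed_def edges_def)
  moreover have "(\<Sum>x\<in>{u, v}. count_list (ins x) e) \<le> (\<Sum>x\<in>K. count_list (ins x) e)"
    using assms fin by (intro sum_mono2) auto
  moreover have "(\<Sum>x\<in>{u, v}. count_list (ins x) e) \<ge> 2"
    using \<open>u \<noteq> v\<close> pos[OF assms(4)] pos[OF assms(5)] by simp
  ultimately show False by simp
qed

lemma well_formed_distinct_ins: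
  assumes K: "well_formed K" and "v \<in> K"
  shows "distinct (ins v)"
proof (cases v)
  case (Crossing k nw ne sw se)
  have "nw \<in> edges K"
    using Crossing assms(2) by (force simp: edges_def)
  then have "(\<Sum>v\<in>K. count_list (ins v) nw) = 1" and fin: "finite K"
    using K by (auto simp: well_formed_def)
  then have "count_list (ins v) nw \<le> 1"
    using member_le_sum[of v K "\<lambda>v. count_list (ins v) nw"] assms(2) by simp
  then show ?thesis
    using Crossing by (auto split: if_splits)
qed simp

lemma set_ins_tile: "set (ins (tile l d1 d2 a b c d)) = {if d1 then a else d, if d2 then b else c}"
  by (cases d1; cases d2) auto

lemma distinct_ins_tile:
  "distinct (ins (tile l d1 d2 a b c d)) \<longleftrightarrow> (if d1 then a else d) \<noteq> (if d2 then b else c)"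
  by (cases d1; cases d2) auto

lemma set_ins_strand: "set (ins (strand d a b)) = {if d then a else b}"
  by (simp add: strand_def)

context biquandle_virtual_bracket
begin

lemma sim_strand':
  assumes "a \<noteq> b" "a \<in> list_edges vs"
  shows "sim (strand d a b # vs) (map (map_vertex (id(a := b))) vs)"
  using sim_strand[of b a vs "\<not> d"] assms by (simp add: strand_reverse)

text \<open>
  Composing both sides with the inverse of the crossing of the first two strands, at the top and
  at the bottom, exchanges these strands.
\<close>

lemma triangle_move_swap:
  assumes "triangle_move l12 l13 l23 d1 d2 d3"
  shows "triangle_move (flip l12) l23 l13 d2 d1 d3"
  unfolding triangle_move_def
proof (intro allI impI)
  fix R a b c d e f p q r
  assume pqr: "distinct [p, q, r]" "{p, q, r} \<inter> (list_edges R \<union> {a, b, c, d, e, f}) = {}"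
  let ?X = "list_edges R \<union> {a, b, c, d, e, f, p, q, r}"
  obtain s t a' b' where fresh: "distinct [s, t, a', b']" "{s, t, a', b'} \<inter> ?X = {}"
    by (rule obtain_fresh4[of ?X]) auto
  have nR: "\<forall>x\<in>{p, q, r, s, t, a', b'}. x \<notin> list_edges R"
    using pqr(2) fresh(2) by auto
  have ne: "\<forall>x\<in>{s, t, a', b'}. \<forall>y\<in>{a, b, c, d, e, f, p, q, r}. x \<noteq> y \<and> y \<noteq> x"
    using fresh(2) by blast
  have ne': "\<forall>x\<in>{p, q, r}. \<forall>y\<in>{a, b, c, d, e, f}. x \<noteq> y \<and> y \<noteq> x"
    using pqr(2) by blast
  have ne'': "s \<noteq> t" "s \<noteq> a'" "s \<noteq> b'" "t \<noteq> a'" "t \<noteq> b'" "a' \<noteq> b'"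
     "t \<noteq> s" "a' \<noteq> s" "b' \<noteq> s" "a' \<noteq> t" "b' \<noteq> t" "b' \<noteq> a'" "p \<noteq> q" "q \<noteq> r" "p \<noteq> r" "q \<noteq> p" "r \<noteq> q" "r \<noteq> p"
    using fresh(1) pqr(1) by auto
  note [simp] = ne[unfolded ball_simps] ne'[unfolded ball_simps] ne'' nR[unfolded ball_simps]
    map_vertex_fresh map_vertex_tile map_vertex_strand
  let ?top = "tile (flip l12) d2 d1 a b s t" and ?bot = "tile (flip l12) d2 d1 r q e f"
  \<comment> \<open>The chain leads from the right side to the left one. The upper ends are first
    subdivided by \<open>a'\<close> and \<open>b'\<close>, so that there are two strands on which
    the second move can create a bigon.\<close>
  have "sim (triangle_right (flip l12) l23 l13 d2 d1 d3 a b c d e f p q r @ R)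
      (strand d1 b b' # triangle_right (flip l12) l23 l13 d2 d1 d3 a b' c d e f p q r @ R)"
    using sim_strand[of b b' "triangle_right (flip l12) l23 l13 d2 d1 d3 a b' c d e f p q r @ R" d1]
    by (simp add: triangle_right_def sim_sym)
  also have "sim \<dots> (strand d2 a a' # strand d1 b b' #
      triangle_right (flip l12) l23 l13 d2 d1 d3 a' b' c d e f p q r @ R)"
    using sim_strand[of a a' "strand d1 b b' #
      triangle_right (flip l12) l23 l13 d2 d1 d3 a' b' c d e f p q r @ R" d2]
    by (simp add: triangle_right_def sim_sym)
  also have "sim \<dots> ([?top, tile l12 d1 d2 s t a' b'] @
      triangle_right (flip l12) l23 l13 d2 d1 d3 a' b' c d e f p q r @ R)"
    using sim_bigon[of s t "triangle_right (flip l12) l23 l13 d2 d1 d3 a' b' c d e f p q r @ R"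
        a b a' b' "flip l12" d2 d1]
    by (simp add: triangle_right_def sim_sym)
  \<comment> \<open>The lower crossing of the bigon and the first two crossings of the right side
    form the left triangle of the given move; \<open>?top\<close> and \<open>?bot\<close> stay
    outside.\<close>
  also have "sim \<dots> (triangle_left l12 l13 l23 d1 d2 d3 s t c d r q a' b' p @ [?top, ?bot] @ R)"
    by (rule sim_mset) (simp add: triangle_right_def triangle_left_def)
  also have "sim \<dots> (triangle_right l12 l13 l23 d1 d2 d3 s t c d r q a' b' p @ [?top, ?bot] @ R)"
    by (rule triangle_moveD[OF assms]) auto
  \<comment> \<open>The move has brought the auxiliary crossing next to \<open>?bot\<close>, with
    which it cancels.\<close>
  also have "sim \<dots> ([tile l12 d1 d2 p b' r q, tile (flip l12) d2 d1 r q e f] @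
      [?top, tile l23 d2 d3 t c a' b', tile l13 d1 d3 s a' d p] @ R)"
    by (rule sim_mset) (simp add: triangle_right_def)
  also have "sim \<dots> ([strand d1 p e, strand d2 b' f] @
      [?top, tile l23 d2 d3 t c a' b', tile l13 d1 d3 s a' d p] @ R)"
    by (rule sim_bigon) auto
  also have "sim \<dots> (strand d2 b' f # [?top, tile l23 d2 d3 t c a' b', tile l13 d1 d3 s a' d e] @ R)"
    using sim_strand'[of p e "strand d2 b' f #
        [?top, tile l23 d2 d3 t c a' b', tile l13 d1 d3 s a' d p] @ R" d1] by simp
  also have "sim \<dots> (triangle_left (flip l12) l23 l13 d2 d1 d3 a b c d e f s t a' @ R)"
    using sim_strand'[of b' f "[?top, tile l23 d2 d3 t c a' b', tile l13 d1 d3 s a' d e] @ R" d2]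
    by (simp add: triangle_left_def)
  also have "sim \<dots> (triangle_left (flip l12) l23 l13 d2 d1 d3 a b c d e f p q r @ R)"
    by (rule sim_triangle_left_rename) (use pqr fresh in auto)
  finally show "sim (triangle_left (flip l12) l23 l13 d2 d1 d3 a b c d e f p q r @ R)
    (triangle_right (flip l12) l23 l13 d2 d1 d3 a b c d e f p q r @ R)"
    by (rule sim_sym)
qed

text \<open>A conjugate of \<open>triangle_move_swap\<close>: after one turn the strands 2, 3 come
  first, are exchanged, and five further turns complete the full turn.\<close>

lemma triangle_move_swap':
  assumes "triangle_move l12 l13 l23 d1 d2 d3"
  shows "triangle_move l13 l12 (flip l23) d1 d3 d2"
  using triangle_move_rotate[OF triangle_move_rotate[OF triangle_move_rotate[OF triangle_move_rotate[OF
    triangle_move_rotate[OF triangle_move_swap[OF triangle_move_rotate[OF assms]]]]]]]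
  by simp

text \<open>One turn puts the reverse of strand 1 last, and two exchanges bring it back to the
  front.\<close>

lemma triangle_move_reverse:
  assumes "triangle_move l12 l13 l23 d1 d2 d3"
  shows "triangle_move l12 l13 l23 (\<not> d1) d2 d3"
  using triangle_move_swap[OF triangle_move_swap'[OF triangle_move_rotate[OF assms]]] by simp

lemma triangle_move_directions:
  assumes "triangle_move l12 l13 l23 True True True"
  shows "triangle_move l12 l13 l23 d1 d2 d3"
proof -
  have 1: "triangle_move l12 l13 l23 x y z"
    if "triangle_move l12 l13 l23 True y z" for l12 l13 l23 x y z
    using that triangle_move_reverse[OF that] by (cases x) auto
  have 2: "triangle_move l12 l13 l23 x y z"
    if "triangle_move l12 l13 l23 x True z" for l12 l13 l23 x y z
    using triangle_move_swap[OF 1[OF triangle_move_swap[OF that]]] by simp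
  have 3: "triangle_move l12 l13 l23 x y z"
    if "triangle_move l12 l13 l23 x y True" for l12 l13 l23 x y z
    using triangle_move_swap'[OF 2[OF triangle_move_swap'[OF that]]] by simp
  show ?thesis
    by (rule 3[OF 2[OF 1[OF assms]]])
qed

text \<open>The six orders of heights give six of the eight patterns of Over and Under; the two
  cyclic patterns do not come from heights. All six are reached from one by exchanging neighboring
  strands.\<close>

lemma triangle_move_passing:
  assumes "distinct [h1, h2, h3]"
  shows "triangle_move (passing h1 h2) (passing h1 h3) (passing h2 h3) d1 d2 d3"
proof -
  note UUU = triangle_move_positive
  note OUU = triangle_move_swap[OF UUU]
  note UUO = triangle_move_swap'[OF UUU]
  note UOO = triangle_move_swap'[OF OUU]
  note OOU = triangle_move_swap[OF UUO]
  note OOO = triangle_move_swap[OF UOO]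
  have "triangle_move (passing h1 h2) (passing h1 h3) (passing h2 h3) True True True"
    using assms UUU OUU UUO UOO OOU OOO by (simp add: passing_def)
  then show ?thesis
    by (rule triangle_move_directions)
qed

text \<open>Exchanges of strands carry the position of the crossing \<open>l\<close> through all
  three pairs.\<close>

lemma triangle_move_mixed:
  assumes "(l12, l13, l23) \<in> {(Flat, Flat, l), (Flat, l, Flat), (l, Flat, Flat)}"
  shows "triangle_move l12 l13 l23 d1 d2 d3"
proof -
  note FFL = triangle_move_flat[of l]
  note FLF = triangle_move_swap[OF FFL]
  note LFF = triangle_move_swap'[OF FLF]
  have "triangle_move l12 l13 l23 True True True"
    using assms FFL FLF LFF by auto
  then show ?thesis
    by (rule triangle_move_directions)
qed

section \<open>Invariance under the moves\<close>

definition invariant :: "diagram \<Rightarrow> diagram \<Rightarrow> bool" where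
  "invariant K L \<longleftrightarrow> same_multiset
     (colorings utri otri K) (state_sum A B C D U V \<delta> w w' K)
     (colorings utri otri L) (state_sum A B C D U V \<delta> w w' L)"

lemma invariant_if_sim:
  assumes "sim vs us" "distinct vs" "distinct us"
  shows "invariant (set vs) (set us)"
proof -
  have "state_sum A B C D U V \<delta> w w' (set ts) = (\<lambda>\<phi>. bracket (list_edges ts) \<phi> ts {})"
    if "distinct ts" for ts
    using state_sum_bracket[OF that] by blast
  then show ?thesis
    using assms by (simp add: sim_def invariant_def)
qed

lemma invariant_local:
  assumes "finite R" "sim (T1 @ r) (T2 @ r)" "set r = R" "distinct r"
    and "distinct T1" "set T1 \<inter> R = {}" "distinct T2" "set T2 \<inter> R = {}"
  shows "invariant (R \<union> set T1) (R \<union> set T2)"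
  using invariant_if_sim[OF assms(2)] assms by (simp add: Un_commute)

section \<open>From lists back to sets of vertices\<close>

lemma fresh_not_in:
  assumes "p \<in> set_vertex v" "p \<notin> edges R"
  shows "v \<notin> R"
  using assms by (auto simp: edges_def)

lemma invariant_kink:
  assumes wf: "well_formed (R \<union> kink l d1 a d p)" and p: "p \<notin> edges R \<union> {a, d}"
  shows "invariant (R \<union> kink l d1 a d p) (R \<union> {strand d1 a d})"
proof -
  from wf have fin: "finite R" by (simp add: well_formed_def)
  then obtain r where r: "set r = R" "distinct r"
    using finite_distinct_list by blast
  let ?v = "tile l d1 d1 a p d p"
  have v: "?v \<notin> R"
    by (rule fresh_not_in[of p]) (use p in auto)
  \<comment> \<open>The edge by which the strand enters the disk ends at the crossing of the kink,
    so it ends at no vertex of \<open>R\<close>.\<close>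
  have "strand d1 a d \<notin> R"
  proof
    assume "strand d1 a d \<in> R"
    then have "?v = strand d1 a d"
      by (intro well_formed_ins_unique[OF wf, of _ _ "if d1 then a else d"])
        (auto simp: kink_def set_ins_tile set_ins_strand)
    with \<open>strand d1 a d \<in> R\<close> v show False by simp
  qed
  moreover have "sim ([?v] @ r) ([strand d1 a d] @ r)"
    using sim_kink_right[of p r a d "parallel_kind l"] sim_kink_left[of p r a d "parallel_kind l"] p r(1)
    by (cases d1) (simp_all add: strand_def)
  ultimately show ?thesis
    using invariant_local[OF fin _ r, of "[?v]" "[strand d1 a d]"] v by (simp add: kink_def)
qed

lemma invariant_bigon:
  assumes wf: "well_formed (R \<union> bigon l d1 d2 a b d e p q)"
    and pq: "p \<noteq> q" "{p, q} \<inter> (edges R \<union> {a, b, d, e}) = {}"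
  shows "invariant (R \<union> bigon l d1 d2 a b d e p q) (R \<union> {strand d1 a d, strand d2 b e})"
proof -
  from wf have fin: "finite R" by (simp add: well_formed_def)
  then obtain r where r: "set r = R" "distinct r"
    using finite_distinct_list by blast
  let ?u = "tile l d1 d2 a b p q" and ?v = "tile (flip l) d2 d1 p q d e"
  let ?s = "strand d1 a d" and ?t = "strand d2 b e"
  have uv: "?u \<notin> R" "?v \<notin> R"
    by (rule fresh_not_in[of p]; use pq in auto)+
  have "set_vertex ?u = {a, b, p, q}" "set_vertex ?v = {p, q, d, e}" by simp_all
  note unique = well_formed_ins_unique[OF wf]
  have mem: "?u \<in> R \<union> bigon l d1 d2 a b d e p q" "?v \<in> R \<union> bigon l d1 d2 a b d e p q"
    by (simp_all add: bigon_def)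
  have dist: "distinct (ins ?u)" "distinct (ins ?v)"
    using well_formed_distinct_ins[OF wf] mem by auto
  have st: "x \<notin> R" if "x = ?s \<or> x = ?t" for x
  proof
    assume "x \<in> R"
    have "set (ins x) \<subseteq> set (ins ?u) \<union> set (ins ?v)"
      using that by (auto simp: set_ins_tile set_ins_strand)
    moreover obtain z where "z \<in> set (ins x)"
      by (cases x) auto
    ultimately have "x = ?u \<or> x = ?v"
      using unique[of x _ z] mem \<open>x \<in> R\<close> by blast
    with \<open>x \<in> R\<close> uv show False by auto
  qed
  have "?u \<noteq> ?v"
    using pq by (cases d1; cases d2) auto
  \<comment> \<open>Equal strands would merge in the set. For parallel strands their first edges are
    the two distinct incoming edges of one crossing; for antiparallel ones they end at different
    crossings.\<close>
  moreover have "?s \<noteq> ?t"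
  proof
    assume "?s = ?t"
    then have z: "(if d1 then a else d) = (if d2 then b else e)"
      by (auto simp: strand_def split: if_splits)
    show False
    proof (cases "d1 = d2")
      case True
      with z dist show False
        by (cases d2) (auto simp: distinct_ins_tile)
    next
      case False
      with z have "(if d1 then a else d) \<in> set (ins ?u)" "(if d1 then a else d) \<in> set (ins ?v)"
        by (cases d1; cases d2; simp add: set_ins_tile)+
      with unique[OF mem] \<open>?u \<noteq> ?v\<close> show False by blast
    qed
  qed
  moreover have "sim ([?u, ?v] @ r) ([?s, ?t] @ r)"
    by (rule sim_bigon) (use pq r(1) in auto)
  ultimately show ?thesis
    using invariant_local[OF fin _ r, of "[?u, ?v]" "[?s, ?t]"] uv st by (simp add: bigon_def)
qed

lemma invariant_triangle:
  assumes move: "triangle_move l12 l13 l23 d1 d2 d3" and fin: "finite R"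
    and pqr: "distinct [p, q, r]" "{p, q, r} \<inter> (edges R \<union> {a, b, c, d, e, f}) = {}"
  shows "invariant (R \<union> left_triangle l12 l13 l23 d1 d2 d3 a b c d e f p q r)
    (R \<union> right_triangle l12 l13 l23 d1 d2 d3 a b c d e f p q r)"
proof -
  obtain xs where xs: "set xs = R" "distinct xs"
    using finite_distinct_list[OF fin] by blast
  let ?l = "triangle_left l12 l13 l23 d1 d2 d3 a b c d e f p q r"
  let ?r = "triangle_right l12 l13 l23 d1 d2 d3 a b c d e f p q r"
  have "v \<notin> R" if "v \<in> set ?l \<union> set ?r" for v
  proof -
    have "set_vertex v \<inter> {p, q, r} \<noteq> {}"
      using that by (auto simp: triangle_left_def triangle_right_def)
    then show ?thesis
      using fresh_not_in[of _ v R] pqr(2) by blast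
  qed
  \<comment> \<open>Any two crossings of a triangle are told apart by an inner edge that lies on
    only one of them.\<close>
  moreover have "distinct ?l" "distinct ?r"
  proof -
    have neq: "u \<noteq> v" if "x \<in> set_vertex u" "x \<notin> set_vertex v" for x and u v :: "nat vertex"
      using that by auto
    show "distinct ?l"
      using pqr neq[of p "tile l12 d1 d2 a b p q" "tile l13 d1 d3 q c r f"]
        neq[of q "tile l12 d1 d2 a b p q" "tile l23 d2 d3 p r d e"]
        neq[of q "tile l13 d1 d3 q c r f" "tile l23 d2 d3 p r d e"]
      by (simp add: triangle_left_def) blast
    show "distinct ?r"
      using pqr neq[of q "tile l23 d2 d3 b c p q" "tile l13 d1 d3 a p d r"]
        neq[of p "tile l23 d2 d3 b c p q" "tile l12 d1 d2 r q e f"]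
        neq[of p "tile l13 d1 d3 a p d r" "tile l12 d1 d2 r q e f"]
      by (simp add: triangle_right_def) blast
  qed
  moreover have "sim (?l @ xs) (?r @ xs)"
    using triangle_moveD[OF move pqr(1)] pqr(2) xs(1) by simp
  moreover have "set ?l = left_triangle l12 l13 l23 d1 d2 d3 a b c d e f p q r"
    "set ?r = right_triangle l12 l13 l23 d1 d2 d3 a b c d e f p q r"
    by (simp_all add: triangle_left_def triangle_right_def left_triangle_def right_triangle_def)
  ultimately show ?thesis
    using invariant_local[OF fin _ xs, of ?l ?r] by auto
qed

lemma invariant_rename:
  assumes "finite K" "inj_on g (edges K)"
  shows "invariant K (map_vertex g ` K)"
proof -
  obtain vs where vs: "set vs = K" "distinct vs"
    using finite_distinct_list[OF assms(1)] by blast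
  have "inj_on (map_vertex g) K"
  proof (rule inj_onI)
    fix u v
    assume "u \<in> K" "v \<in> K" "map_vertex g u = map_vertex g v"
    then show "u = v"
      using assms(2) by (intro vertex.inj_map_strong[of u v g g]) (auto simp: edges_def inj_on_def)
  qed
  then show ?thesis
    using invariant_if_sim[OF sim_rename[of g vs]] vs assms(2) by (simp add: distinct_map)
qed

lemma invariant_unmark:
  assumes wf: "well_formed (R \<union> {Mark a b})" and "a \<noteq> b" "Mark a b \<notin> R"
  shows "invariant (R \<union> {Mark a b}) (map_vertex (id(b := a)) ` R)"
proof -
  let ?K = "R \<union> {Mark a b}" and ?f = "id(b := a)"
  from wf have "finite R" by (simp add: well_formed_def)
  then obtain vs where vs: "set vs = R" "distinct vs"
    using finite_distinct_list by blast
  \<comment> \<open>The edge \<open>b\<close> must end somewhere, and since \<open>a\<close> differs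
    from \<open>b\<close> it does not end at the mark. Hence it occurs in \<open>R\<close>, as
    \<open>sim_unmark\<close> requires.\<close>
  have "b \<in> edges ?K" by simp
  then have "(\<Sum>v\<in>?K. count_list (ins v) b) = 1"
    using wf by (auto simp: well_formed_def)
  then have "\<exists>v\<in>?K. count_list (ins v) b \<noteq> 0"
    by (metis sum.neutral zero_neq_one)
  then obtain v where "v \<in> ?K" "count_list (ins v) b \<noteq> 0"
    by blast
  then have "v \<in> ?K" "b \<in> set (ins v)"
    by (simp_all add: count_list_0_iff)
  then have "v \<in> R" "b \<in> set_vertex v"
    using assms(2) by (auto, cases v) auto
  then have b: "b \<in> list_edges vs"
    using vs(1) by (auto simp: edges_def)
  have "inj_on (map_vertex ?f) R"
  proof (rule inj_onI)
    fix u v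
    assume uv: "u \<in> R" "v \<in> R" "map_vertex ?f u = map_vertex ?f v"
    \<comment> \<open>Since \<open>a\<close> ends at the removed mark, it is incoming at no vertex
      of \<open>R\<close>. Replacing \<open>b\<close> by \<open>a\<close> therefore keeps incoming
      edges distinct and cannot merge two vertices.\<close>
    have no_a: "a \<notin> set (ins x)" if "x \<in> R" for x
      using well_formed_ins_unique[OF wf, of x "Mark a b" a] that assms(3) by auto
    have map_ins: "ins (map_vertex ?f x) = map ?f (ins x)" for x
      by (cases x) auto
    obtain e where e: "e \<in> set (ins u)"
      by (cases u) auto
    then have "?f e \<in> set (map ?f (ins v))"
      using map_ins[of u] map_ins[of v] uv(3) by (metis image_eqI set_map)
    then obtain e' where e': "e' \<in> set (ins v)" "?f e = ?f e'"
      by auto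
    with e no_a[OF uv(1)] no_a[OF uv(2)] have "e = e'"
      by (auto split: if_splits)
    with e e' show "u = v"
      using well_formed_ins_unique[OF wf, of u v e] uv by auto
  qed
  then show ?thesis
    using invariant_if_sim[OF sim_unmark[OF assms(2) b]] vs assms(3) by (simp add: distinct_map)
qed

lemma invariant_move:
  assumes "move K L" "virtual_link_diagram K"
  shows "invariant K L"
proof -
  have wf: "well_formed K" "finite K"
    using assms(2) by (auto simp: virtual_link_diagram_def well_formed_def)
  show ?thesis
    using assms(1) wf
  proof cases
    case (rename g)
    then show ?thesis using invariant_rename[OF wf(2)] by simp
  next
    case (unmark a b R)
    then show ?thesis using invariant_unmark[of R a b] wf(1) by simp
  next
    case (I l p R a d d1)
    then show ?thesis using invariant_kink[of R l d1 a d p] wf(1) by simp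
  next
    case (II l p q R a b d e d1 d2)
    then show ?thesis using invariant_bigon[of R l d1 d2 a b d e p q] wf(1) by simp
  next
    case (III h1 h2 h3 l12 l13 l23 p q r R a b c d e f d1 d2 d3)
    then show ?thesis
      using wf(2) by (auto intro!: invariant_triangle triangle_move_passing)
  next
    case (vI p R a d d1)
    then show ?thesis using invariant_kink[of R Flat d1 a d p] wf(1) by simp
  next
    case (vII p q R a b d e d1 d2)
    then show ?thesis using invariant_bigon[of R Flat d1 d2 a b d e p q] wf(1) by simp
  next
    case (vIII p q r R a b c d e f d1 d2 d3)
    then show ?thesis
      using wf(2) by (auto intro!: invariant_triangle triangle_move_mixed)
  next
    case (v l l12 l13 l23 p q r R a b c d e f d1 d2 d3)
    from v(4) have "triangle_move l12 l13 l23 d1 d2 d3"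
      by (rule triangle_move_mixed)
    with v wf(2) show ?thesis
      by (simp add: invariant_triangle)
  qed
qed

text \<open>That \<open>L\<close> is a diagram is carried through the induction because
  \<open>invariant_move\<close> needs it of the source of a forward step.\<close>

lemma invariant_equivalent: "equivalent K L \<Longrightarrow> virtual_link_diagram L \<and> invariant K L"
proof (induction rule: equivalent.induct)
  case (refl K)
  then show ?case by (simp add: invariant_def same_multiset_refl)
next
  case (forward K L M)
  then show ?case
    using invariant_move[of L M] unfolding invariant_def by (blast intro: same_multiset_trans)
next
  case (backward K L M)
  then show ?case
    using invariant_move[of M L] unfolding invariant_def
    by (blast intro: same_multiset_trans same_multiset_sym)
qed

end

theorem corollary3:
  fixes utri otri :: "'x \<Rightarrow> 'x \<Rightarrow> 'x"
    and A B C D U V :: "'x \<Rightarrow> 'x \<Rightarrow> 'r::{comm_ring, comm_monoid_mult}"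
    and \<delta> w w' :: 'r
    and K L :: diagram
  assumes "biquandle_virtual_bracket utri otri A B C D U V \<delta> w w'"
    and "equivalent K L"
  shows "same_multiset
           (colorings utri otri K) (state_sum A B C D U V \<delta> w w' K)
           (colorings utri otri L) (state_sum A B C D U V \<delta> w w' L)"
proof -
  interpret biquandle_virtual_bracket utri otri A B C D U V \<delta> w w'
    by (rule assms(1))
  show ?thesis
    using invariant_equivalent[OF assms(2)] by (simp add: invariant_def)
qed

end
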